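(* If $(g,c,m)$ is an e-admissible triplet of integers with $3\le g\le c\le m$ and $r$ is a positive integer, then $$\alpha(rg,rc,rm)\le r\,\alpha(g,c,m)\le r\,\beta(g,c,m)\le\beta(rg,rc,rm).$$
   Context: All graphs are finite, simple and connected. A graph $G$ is regarded as a geodesic metric space by identifying each edge isometrically with $[0,1]$; points are vertices and interior points of edges, $d$ is the shortest-path length. A geodesic triangle $T=\{x,y,z\}$ is a union of three geodesics $[xy],[yz],[zx]$; $\delta(T)$ is the infimum of $\delta\ge0$ such that each side lies in the $\delta$-neighbourhood of the union of the other two; $\delta(G)=\sup_T\delta(T)$ over geodesic triangles. Girth / circumference: length of a shortest / longest cycle. $\mathcal{H}(g,c,m)$ is the set of graphs with girth $g$, circumference $c$ and $m$ edges; $\alpha(g,c,m)=\min\{\delta(G):G\in\mathcal{H}(g,c,m)\}$, $\beta(g,c,m)=\max\{\delta(G):G\in\mathcal{H}(g,c,m)\}$. A triplet $(g,c,m)$ is e-admissible if $\mathcal{H}(g,c,m)\ne\emptyset$. *)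

theory Defs
  imports Complex_Main "HOL-Library.Extended_Nat"
begin

section \<open>Finite simple connected graphs\<close>

text \<open>A graph is a pair of a vertex set and a set of two-element edges.\<close>

type_synonym 'a sgraph = "'a set \<times> 'a set set"

definition verts :: "'a sgraph \<Rightarrow> 'a set" where
  "verts G = fst G"

definition edges :: "'a sgraph \<Rightarrow> 'a set set" where
  "edges G = snd G"

definition finite_simple_graph :: "'a sgraph \<Rightarrow> bool" where
  "finite_simple_graph G \<longleftrightarrow>
     finite (verts G) \<and> (\<forall>e\<in>edges G. e \<subseteq> verts G \<and> card e = 2)"

definition connected_graph :: "'a sgraph \<Rightarrow> bool" where
  "connected_graph G \<longleftrightarrow> verts G \<noteq> {} \<and>
     (\<forall>u\<in>verts G. \<forall>v\<in>verts G. (u, v) \<in> {(a, b). {a, b} \<in> edges G}\<^sup>*)"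

text \<open>A cycle is given by the list of its vertices, without repeating the first one at
  the end, so the length of the list is the length of the cycle.\<close>

definition cycles :: "'a sgraph \<Rightarrow> 'a list set" where
  "cycles G = {vs. length vs \<ge> 3 \<and> distinct vs \<and> set vs \<subseteq> verts G \<and>
     (\<forall>i<length vs. {vs ! i, vs ! (Suc i mod length vs)} \<in> edges G)}"

text \<open>An acyclic graph has girth \<open>\<infinity>\<close>; in particular its girth is not a natural number.\<close>

definition girth :: "'a sgraph \<Rightarrow> enat" where
  "girth G = (INF vs\<in>cycles G. enat (length vs))"

definition circumference :: "'a sgraph \<Rightarrow> enat" where
  "circumference G = (SUP vs\<in>cycles G. enat (length vs))"

section \<open>A graph as a metric space\<close>

text \<open>Points are given by barycentric coordinates: the vertex \<open>v\<close> is the indicator function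
  of \<open>{v}\<close>, and the point of an edge \<open>{u, v}\<close> at distance \<open>t\<close> from \<open>u\<close> takes the value
  \<open>1 - t\<close> at \<open>u\<close>, the value \<open>t\<close> at \<open>v\<close>, and \<open>0\<close> elsewhere.\<close>

definition cell :: "'a set \<Rightarrow> ('a \<Rightarrow> real) set" where
  "cell s = {p. (\<forall>v. 0 \<le> p v) \<and> (\<forall>v. v \<notin> s \<longrightarrow> p v = 0) \<and> (\<Sum>v\<in>s. p v) = 1}"

definition points :: "'a sgraph \<Rightarrow> ('a \<Rightarrow> real) set" where
  "points G = (\<Union>v\<in>verts G. cell {v}) \<union> (\<Union>e\<in>edges G. cell e)"

text \<open>\<open>path_length G p q l\<close>: there is a path from \<open>p\<close> to \<open>q\<close> of length \<open>l\<close> that is a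
  concatenation of finitely many segments, each contained in an edge. For \<open>p\<close> and \<open>q\<close> on an
  edge \<open>e\<close> the value \<open>\<bar>p u - q u\<bar>\<close> is the same for both end points \<open>u\<close> of \<open>e\<close>, and is the
  length of the segment \<open>pq\<close> under the identification of \<open>e\<close> with \<open>[0,1]\<close>.\<close>

inductive path_length :: "'a sgraph \<Rightarrow> ('a \<Rightarrow> real) \<Rightarrow> ('a \<Rightarrow> real) \<Rightarrow> real \<Rightarrow> bool"
  for G :: "'a sgraph" where
  refl: "p \<in> points G \<Longrightarrow> path_length G p p 0"
| step: "e \<in> edges G \<Longrightarrow> u \<in> e \<Longrightarrow> p \<in> cell e \<Longrightarrow> q \<in> cell e \<Longrightarrow> path_length G q x l \<Longrightarrow>
     path_length G p x (\<bar>p u - q u\<bar> + l)"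

definition gdist :: "'a sgraph \<Rightarrow> ('a \<Rightarrow> real) \<Rightarrow> ('a \<Rightarrow> real) \<Rightarrow> real" where
  "gdist G p q = Inf {l. path_length G p q l}"

section \<open>Geodesic triangles and the hyperbolicity constant\<close>

text \<open>In this section \<open>X\<close> is the carrier and \<open>d\<close> the distance of a metric space.\<close>

definition geodesic :: "'b set \<Rightarrow> ('b \<Rightarrow> 'b \<Rightarrow> real) \<Rightarrow> 'b \<Rightarrow> 'b \<Rightarrow> 'b set \<Rightarrow> bool" where
  "geodesic X d x y A \<longleftrightarrow>
     (\<exists>\<gamma>. \<gamma> ` {0..d x y} = A \<and> A \<subseteq> X \<and> \<gamma> 0 = x \<and> \<gamma> (d x y) = y \<and>
        (\<forall>s\<in>{0..d x y}. \<forall>t\<in>{0..d x y}. d (\<gamma> s) (\<gamma> t) = \<bar>s - t\<bar>))"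

text \<open>A geodesic triangle is represented by its three sides. Its corners need not be
  distinct.\<close>

definition geodesic_triangles ::
  "'b set \<Rightarrow> ('b \<Rightarrow> 'b \<Rightarrow> real) \<Rightarrow> ('b set \<times> 'b set \<times> 'b set) set" where
  "geodesic_triangles X d = {(A, B, C). \<exists>x\<in>X. \<exists>y\<in>X. \<exists>z\<in>X.
     geodesic X d x y A \<and> geodesic X d y z B \<and> geodesic X d z x C}"

definition neighbourhood :: "'b set \<Rightarrow> ('b \<Rightarrow> 'b \<Rightarrow> real) \<Rightarrow> real \<Rightarrow> 'b set \<Rightarrow> 'b set" where
  "neighbourhood X d \<epsilon> S = {p\<in>X. \<exists>q\<in>S. d p q \<le> \<epsilon>}"

definition triangle_delta ::
  "'b set \<Rightarrow> ('b \<Rightarrow> 'b \<Rightarrow> real) \<Rightarrow> 'b set \<times> 'b set \<times> 'b set \<Rightarrow> real" where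
  "triangle_delta X d = (\<lambda>(A, B, C). Inf {\<epsilon>. 0 \<le> \<epsilon> \<and>
     A \<subseteq> neighbourhood X d \<epsilon> (B \<union> C) \<and>
     B \<subseteq> neighbourhood X d \<epsilon> (C \<union> A) \<and>
     C \<subseteq> neighbourhood X d \<epsilon> (A \<union> B)})"

text \<open>The supremum is taken over a bounded set when the space has finite diameter, as is the
  case for a finite connected graph.\<close>

definition hyp_const :: "'b set \<Rightarrow> ('b \<Rightarrow> 'b \<Rightarrow> real) \<Rightarrow> real" where
  "hyp_const X d = (SUP T\<in>geodesic_triangles X d. triangle_delta X d T)"

definition graph_delta :: "'a sgraph \<Rightarrow> real" where
  "graph_delta G = hyp_const (points G) (gdist G)"

section \<open>Graphs with given girth, circumference and number of edges\<close>

text \<open>Every finite graph is isomorphic to one whose vertices are natural numbers. For given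
  parameters there are only finitely many isomorphism types, so the minimum and the maximum
  below are over finite sets of reals.\<close>

definition graph_class :: "nat \<Rightarrow> nat \<Rightarrow> nat \<Rightarrow> nat sgraph set" where
  "graph_class g c m = {G. finite_simple_graph G \<and> connected_graph G \<and>
     girth G = enat g \<and> circumference G = enat c \<and> card (edges G) = m}"

definition alpha :: "nat \<Rightarrow> nat \<Rightarrow> nat \<Rightarrow> real" where
  "alpha g c m = Min (graph_delta ` graph_class g c m)"

definition beta :: "nat \<Rightarrow> nat \<Rightarrow> nat \<Rightarrow> real" where
  "beta g c m = Max (graph_delta ` graph_class g c m)"

definition e_admissible :: "nat \<Rightarrow> nat \<Rightarrow> nat \<Rightarrow> bool" where
  "e_admissible g c m \<longleftrightarrow> graph_class g c m \<noteq> {}"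

end

theory Submission imports Defs begin

text \<open>Replacing every edge of \<open>G\<close> by a path of \<open>r\<close> edges gives a graph whose metric space is
  that of \<open>G\<close> dilated by \<open>r\<close>, so its hyperbolicity constant is multiplied by \<open>r\<close>. A cycle of the
  new graph cannot turn back inside an old edge, so the cycles are exactly the subdivided cycles
  of \<open>G\<close>, and girth, circumference and number of edges are multiplied by \<open>r\<close> as well. Hence
  \<open>r \<delta>(G)\<close> is attained in \<open>\<H>(rg, rc, rm)\<close> whenever \<open>\<delta>(G)\<close> is attained in \<open>\<H>(g, c, m)\<close>. The
  case \<open>r = 1\<close>, where \<open>G\<close> is merely relabelled, shows that only finitely many values \<open>\<delta>(G)\<close>
  occur in a class, so that \<open>Min\<close> and \<open>Max\<close> are meaningful.\<close>

section \<open>Scaling the hyperbolicity constant\<close>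

text \<open>Corners of triangles may be interior points of edges, and distances are infima over
  paths through such points, so the dilation must be a map between all points, not only between
  vertices. New vertices are therefore taken to be points of \<open>G\<close> itself, at multiples
  of \<open>1/r\<close> along its edges. Ends shared by several edges are then identified
  automatically, and the affine extension of this inclusion, \<open>place\<close>, is the map
  between the metric spaces. It scales distances by \<open>1/r\<close>; beyond that the transfer of
  triangles uses only that it is onto. Infima and suprema of reals behave well only on non-empty
  bounded sets, and \<open>Min\<close> and \<open>Max\<close> on non-empty finite ones. A bound on
  all distances in a connected graph secures the former, and a bound on the number of vertices in
  terms of \<open>m\<close> the latter.\<close>

lemma Inf_mult_left:
  fixes S :: "real set"
  assumes "0 < k" "S \<noteq> {}" "bdd_below S"
  shows "Inf ((\<lambda>x. k * x) ` S) = k * Inf S"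
proof (rule cInf_eq_non_empty)
  show "(\<lambda>x. k * x) ` S \<noteq> {}" using assms by auto
  show "k * Inf S \<le> x" if "x \<in> (\<lambda>x. k * x) ` S" for x
    using that assms by (auto intro: cInf_lower mult_left_mono)
  fix y assume y: "\<And>x. x \<in> (\<lambda>x. k * x) ` S \<Longrightarrow> y \<le> x"
  have "y / k \<le> Inf S"
    using assms y by (intro cInf_greatest) (auto simp: field_simps)
  then show "y \<le> k * Inf S" using assms by (simp add: field_simps)
qed

lemma Sup_mult_left:
  fixes S :: "real set"
  assumes "0 < k" "S \<noteq> {}" "bdd_above S"
  shows "Sup ((\<lambda>x. k * x) ` S) = k * Sup S"
proof (rule cSup_eq_non_empty)
  show "(\<lambda>x. k * x) ` S \<noteq> {}" using assms by auto
  show "x \<le> k * Sup S" if "x \<in> (\<lambda>x. k * x) ` S" for x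
    using that assms by (auto intro: cSup_upper mult_left_mono)
  fix y assume y: "\<And>x. x \<in> (\<lambda>x. k * x) ` S \<Longrightarrow> x \<le> y"
  have "Sup S \<le> y / k"
    using assms y by (intro cSup_least) (auto simp: field_simps)
  then show "k * Sup S \<le> y" using assms by (simp add: field_simps)
qed

definition delta_bounds ::
  "'b set \<Rightarrow> ('b \<Rightarrow> 'b \<Rightarrow> real) \<Rightarrow> 'b set \<Rightarrow> 'b set \<Rightarrow> 'b set \<Rightarrow> real set" where
  "delta_bounds X d A B C = {\<epsilon>. 0 \<le> \<epsilon> \<and>
     A \<subseteq> neighbourhood X d \<epsilon> (B \<union> C) \<and>
     B \<subseteq> neighbourhood X d \<epsilon> (C \<union> A) \<and>
     C \<subseteq> neighbourhood X d \<epsilon> (A \<union> B)}"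

lemma triangle_delta_eq: "triangle_delta X d (A, B, C) = Inf (delta_bounds X d A B C)"
  by (simp add: triangle_delta_def delta_bounds_def)

lemma geodesic_subset: "geodesic X d x y A \<Longrightarrow> A \<subseteq> X"
  by (auto simp: geodesic_def)

lemma geodesic_nonempty:
  assumes "geodesic X d x y A" "0 \<le> d x y" shows "A \<noteq> {}"
  using assms by (auto simp: geodesic_def)

text \<open>Sides are non-empty, so any point of one side is within \<open>D\<close> of a point of
  another. This makes the set under the infimum in \<open>triangle_delta\<close> non-empty, and it
  bounds the supremum in \<open>hyp_const\<close>.\<close>

lemma diameter_mem_delta_bounds:
  assumes "(A, B, C) \<in> geodesic_triangles X d"
    and "\<And>x y. x \<in> X \<Longrightarrow> y \<in> X \<Longrightarrow> 0 \<le> d x y \<and> d x y \<le> D"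
  shows "D \<in> delta_bounds X d A B C"
proof -
  obtain x y z where xyz: "x \<in> X" "y \<in> X" "z \<in> X"
    "geodesic X d x y A" "geodesic X d y z B" "geodesic X d z x C"
    using assms(1) by (auto simp: geodesic_triangles_def)
  have sub: "A \<subseteq> X" "B \<subseteq> X" "C \<subseteq> X" using xyz geodesic_subset by metis+
  have "A \<noteq> {}" "B \<noteq> {}" "C \<noteq> {}" using xyz assms(2) geodesic_nonempty by metis+
  then obtain a b c where abc: "a \<in> A" "b \<in> B" "c \<in> C" by blast
  have D: "0 \<le> D" using assms(2) xyz(1) by force
  have nb: "P \<subseteq> neighbourhood X d D Q" if "P \<subseteq> X" "q \<in> Q" "q \<in> X" for P Q q
    using that assms(2) unfolding neighbourhood_def by blast
  from D nb[OF sub(1), of b "B \<union> C"] nb[OF sub(2), of c "C \<union> A"]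
    nb[OF sub(3), of a "A \<union> B"]
  show ?thesis using sub abc unfolding delta_bounds_def by blast
qed

text \<open>The image geodesic is the old one run at speed \<open>1 / k\<close>, so that it is again
  parametrised by arc length.\<close>

lemma geodesic_dilation:
  assumes k: "0 < k" and f: "f ` X \<subseteq> Y"
    and d: "\<And>x y. x \<in> X \<Longrightarrow> y \<in> X \<Longrightarrow> d' (f x) (f y) = k * d x y"
    and "x \<in> X" "y \<in> X" "geodesic X d x y A"
  shows "geodesic Y d' (f x) (f y) (f ` A)"
proof -
  obtain \<gamma> where g: "\<gamma> ` {0..d x y} = A" "A \<subseteq> X" "\<gamma> 0 = x" "\<gamma> (d x y) = y"
    "\<forall>s\<in>{0..d x y}. \<forall>t\<in>{0..d x y}. d (\<gamma> s) (\<gamma> t) = \<bar>s - t\<bar>"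
    using assms(6) by (auto simp: geodesic_def)
  have dxy: "d' (f x) (f y) = k * d x y" using assms by blast
  have im: "{0..k * d x y} = (\<lambda>s. k * s) ` {0..d x y}"
    using k by (simp add: image_mult_atLeastAtMost)
  show ?thesis unfolding geodesic_def dxy
  proof (intro exI[of _ "\<lambda>s. f (\<gamma> (s / k))"] conjI)
    show "f ` A \<subseteq> Y" using g(2) f by blast
    show "(\<lambda>s. f (\<gamma> (s / k))) ` {0..k * d x y} = f ` A"
      unfolding im g(1)[symmetric] image_image using k by (intro image_cong) auto
    show "\<forall>s\<in>{0..k * d x y}. \<forall>t\<in>{0..k * d x y}. d' (f (\<gamma> (s / k))) (f (\<gamma> (t / k))) = \<bar>s - t\<bar>"
    proof (intro ballI)
      fix s t assume "s \<in> {0..k * d x y}" "t \<in> {0..k * d x y}"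
      then obtain s' t' where st: "s = k * s'" "t = k * t'" "s' \<in> {0..d x y}" "t' \<in> {0..d x y}"
        unfolding im by blast
      then have "d' (f (\<gamma> s')) (f (\<gamma> t')) = k * \<bar>s' - t'\<bar>"
        using g d by (metis imageI subsetD)
      also have "\<dots> = \<bar>k * s' - k * t'\<bar>"
        using k by (simp add: abs_mult flip: right_diff_distrib)
      finally show "d' (f (\<gamma> (s / k))) (f (\<gamma> (t / k))) = \<bar>s - t\<bar>"
        using k st by simp
    qed
  qed (use g f k in auto)
qed

lemma delta_bounds_dilation:
  assumes k: "0 < k" and f: "f ` X \<subseteq> Y"
    and d: "\<And>x y. x \<in> X \<Longrightarrow> y \<in> X \<Longrightarrow> d' (f x) (f y) = k * d x y"
    and sub: "A \<subseteq> X" "B \<subseteq> X" "C \<subseteq> X"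
  shows "delta_bounds Y d' (f ` A) (f ` B) (f ` C) = (\<lambda>\<epsilon>. k * \<epsilon>) ` delta_bounds X d A B C"
proof -
  have nb: "f ` P \<subseteq> neighbourhood Y d' (k * \<epsilon>) (f ` Q \<union> f ` R) \<longleftrightarrow> P \<subseteq> neighbourhood X d \<epsilon> (Q \<union> R)"
    if "P \<subseteq> X" "Q \<subseteq> X" "R \<subseteq> X" for P Q R \<epsilon>
  proof -
    have "f p \<in> neighbourhood Y d' (k * \<epsilon>) (f ` (Q \<union> R)) \<longleftrightarrow> p \<in> neighbourhood X d \<epsilon> (Q \<union> R)"
      if "p \<in> X" for p
    proof -
      have "d' (f p) (f q) \<le> k * \<epsilon> \<longleftrightarrow> d p q \<le> \<epsilon>" if "q \<in> Q \<union> R" for q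
        using d[of p q] \<open>p \<in> X\<close> that \<open>Q \<subseteq> X\<close> \<open>R \<subseteq> X\<close> k by auto
      then show ?thesis using \<open>p \<in> X\<close> f unfolding neighbourhood_def by blast
    qed
    then show ?thesis using \<open>P \<subseteq> X\<close> unfolding image_Un by blast
  qed
  have mem: "k * \<epsilon> \<in> delta_bounds Y d' (f ` A) (f ` B) (f ` C) \<longleftrightarrow> \<epsilon> \<in> delta_bounds X d A B C" for \<epsilon>
    using k sub by (simp add: delta_bounds_def nb zero_le_mult_iff)
  show ?thesis
  proof (intro set_eqI iffI)
    fix \<epsilon> assume "\<epsilon> \<in> delta_bounds Y d' (f ` A) (f ` B) (f ` C)"
    then have "\<epsilon> / k \<in> delta_bounds X d A B C" using mem[of "\<epsilon> / k"] k by simp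
    then show "\<epsilon> \<in> (\<lambda>\<epsilon>. k * \<epsilon>) ` delta_bounds X d A B C"
      using k by (intro image_eqI[of _ _ "\<epsilon> / k"]) auto
  qed (auto simp: mem)
qed

text \<open>Triangles are transported in one direction only, and \<open>f\<close> need not be onto.
  The lemma can thus be applied both to a dilation and to a right inverse of it.\<close>

lemma triangle_delta_dilation:
  assumes k: "0 < k" and f: "f ` X \<subseteq> Y"
    and d: "\<And>x y. x \<in> X \<Longrightarrow> y \<in> X \<Longrightarrow> d' (f x) (f y) = k * d x y"
    and D: "\<And>x y. x \<in> X \<Longrightarrow> y \<in> X \<Longrightarrow> 0 \<le> d x y \<and> d x y \<le> D"
    and T: "T \<in> geodesic_triangles X d"
  shows "\<exists>T'\<in>geodesic_triangles Y d'. triangle_delta Y d' T' = k * triangle_delta X d T"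
proof -
  obtain A B C where ABC: "T = (A, B, C)" by (cases T)
  obtain x y z where xyz: "x \<in> X" "y \<in> X" "z \<in> X"
    "geodesic X d x y A" "geodesic X d y z B" "geodesic X d z x C"
    using T ABC by (auto simp: geodesic_triangles_def)
  have sub: "A \<subseteq> X" "B \<subseteq> X" "C \<subseteq> X" using xyz geodesic_subset by metis+
  have "(f ` A, f ` B, f ` C) \<in> geodesic_triangles Y d'"
    using geodesic_dilation[where d = d and d' = d', OF k f d] xyz f unfolding geodesic_triangles_def by blast
  moreover have "triangle_delta Y d' (f ` A, f ` B, f ` C) = k * triangle_delta X d T"
  proof -
    have "delta_bounds Y d' (f ` A) (f ` B) (f ` C) = (\<lambda>\<epsilon>. k * \<epsilon>) ` delta_bounds X d A B C"
      using k f d sub by (rule delta_bounds_dilation)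
    moreover have "Inf ((\<lambda>\<epsilon>. k * \<epsilon>) ` delta_bounds X d A B C) = k * Inf (delta_bounds X d A B C)"
    proof (rule Inf_mult_left[OF k])
      show "delta_bounds X d A B C \<noteq> {}"
        using diameter_mem_delta_bounds[where d = d, OF _ D] T ABC by blast
      show "bdd_below (delta_bounds X d A B C)"
        by (rule bdd_belowI[of _ 0]) (simp add: delta_bounds_def)
    qed
    ultimately show ?thesis by (simp add: ABC triangle_delta_eq)
  qed
  ultimately show ?thesis by blast
qed

text \<open>A right inverse of \<open>f\<close> is a dilation by \<open>1 / k\<close>, so triangles
  can be carried both ways and the two sets of values of \<open>triangle_delta\<close> correspond
  under multiplication by \<open>k\<close>.\<close>

lemma hyp_const_dilation:
  assumes k: "0 < k" and f: "f ` X = Y" and ne: "X \<noteq> {}"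
    and d: "\<And>x y. x \<in> X \<Longrightarrow> y \<in> X \<Longrightarrow> d' (f x) (f y) = k * d x y"
    and D: "\<And>x y. x \<in> X \<Longrightarrow> y \<in> X \<Longrightarrow> 0 \<le> d x y \<and> d x y \<le> D"
    and refl: "\<And>x. x \<in> X \<Longrightarrow> d x x = 0"
  shows "hyp_const Y d' = k * hyp_const X d"
proof -
  define g where "g = inv_into X f"
  have g: "g ` Y \<subseteq> X" "\<And>y. y \<in> Y \<Longrightarrow> f (g y) = y"
    unfolding g_def using f by (auto intro: inv_into_into f_inv_into_f)
  have dg: "d (g x) (g y) = (1 / k) * d' x y" if "x \<in> Y" "y \<in> Y" for x y
  proof -
    have "g x \<in> X" "g y \<in> X" using that g(1) by auto
    then show ?thesis using d[of "g x" "g y"] that k g(2) by simp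
  qed
  have D': "0 \<le> d' x y \<and> d' x y \<le> k * D" if "x \<in> Y" "y \<in> Y" for x y
    using that D k unfolding f[symmetric] by (auto simp: d)
  have "triangle_delta Y d' ` geodesic_triangles Y d'
      = (\<lambda>\<delta>. k * \<delta>) ` triangle_delta X d ` geodesic_triangles X d"
  proof (intro equalityI subsetI)
    fix s assume "s \<in> triangle_delta Y d' ` geodesic_triangles Y d'"
    then obtain T where T: "T \<in> geodesic_triangles Y d'" "s = triangle_delta Y d' T" by blast
    obtain T' where "T' \<in> geodesic_triangles X d" "triangle_delta X d T' = (1 / k) * s"
      using triangle_delta_dilation[where d = d' and d' = d and f = g and k = "1 / k", OF _ g(1) dg D' T(1)] k T(2) by auto
    then show "s \<in> (\<lambda>\<delta>. k * \<delta>) ` triangle_delta X d ` geodesic_triangles X d"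
      using k by (force simp: image_image)
  next
    fix s assume "s \<in> (\<lambda>\<delta>. k * \<delta>) ` triangle_delta X d ` geodesic_triangles X d"
    then obtain T where T: "T \<in> geodesic_triangles X d" "s = k * triangle_delta X d T" by blast
    have "f ` X \<subseteq> Y" using f by simp
    from triangle_delta_dilation[where d = d and d' = d', OF k this d D T(1)] T(2)
    show "s \<in> triangle_delta Y d' ` geodesic_triangles Y d'" by (metis imageI)
  qed
  moreover have "geodesic_triangles X d \<noteq> {}"
  proof -
    obtain x where x: "x \<in> X" using ne by blast
    \<comment> \<open>The degenerate triangle at \<open>x\<close> keeps the supremum from being
      taken over the empty set.\<close>
    then have "geodesic X d x x {x}"
      unfolding geodesic_def by (intro exI[of _ "\<lambda>_. x"]) (auto simp: refl)
    then show ?thesis using x unfolding geodesic_triangles_def by blast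
  qed
  moreover have "bdd_above (triangle_delta X d ` geodesic_triangles X d)"
  proof (rule bdd_aboveI2)
    fix T assume T: "T \<in> geodesic_triangles X d"
    obtain A B C where ABC: "T = (A, B, C)" by (cases T)
    show "triangle_delta X d T \<le> D"
      unfolding ABC triangle_delta_eq
    proof (rule cInf_lower)
      show "D \<in> delta_bounds X d A B C"
        using diameter_mem_delta_bounds[where d = d, OF _ D] T ABC by blast
      show "bdd_below (delta_bounds X d A B C)"
        by (rule bdd_belowI[of _ 0]) (simp add: delta_bounds_def)
    qed
  qed
  ultimately show ?thesis
    unfolding hyp_const_def by (simp add: Sup_mult_left[OF k])
qed

section \<open>Paths in a finite connected graph\<close>

text \<open>The point at distance \<open>t\<close> from \<open>a\<close> on the edge
  \<open>ab\<close>. At \<open>t = 0\<close> the second end is irrelevant, so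
  \<open>seg u u 0\<close> denotes the vertex \<open>u\<close> without the choice of a
  neighbour.\<close>

definition seg :: "'a \<Rightarrow> 'a \<Rightarrow> real \<Rightarrow> 'a \<Rightarrow> real" where
  "seg a b t = (\<lambda>v. if v = a then 1 - t else if v = b then t else 0)"

lemma seg_swap: "a \<noteq> b \<Longrightarrow> seg a b t = seg b a (1 - t)"
  by (auto simp: seg_def)

lemma seg_0_cong: "seg a b 0 = seg a c 0"
  by (auto simp: seg_def)

text \<open>An interior point has support \<open>{a, b}\<close>, which determines the edge; the
  parameter is then determined up to the direction of the edge.\<close>

lemma seg_interior_eq:
  assumes "seg a b s = seg c d t" "0 < s" "s < 1" "a \<noteq> b" "c \<noteq> d"
  shows "a = c \<and> b = d \<and> t = s \<or> a = d \<and> b = c \<and> t = 1 - s"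
  using fun_cong[OF assms(1), of a] fun_cong[OF assms(1), of b] assms(2-)
  by (auto simp: seg_def split: if_splits)

lemma seg_0_eq:
  assumes "seg a b 0 = seg c d t"
  shows "a = c \<and> t = 0 \<or> a = d \<and> t = 1"
  using fun_cong[OF assms, of a] by (auto simp: seg_def split: if_splits)

lemma cell_pair:
  assumes "a \<noteq> b" shows "cell {a, b} = seg a b ` {0..1}"
proof (intro equalityI subsetI)
  fix p assume "p \<in> cell {a, b}"
  then have p: "\<And>v. 0 \<le> p v" "\<And>v. v \<notin> {a, b} \<Longrightarrow> p v = 0" "p a + p b = 1"
    using assms by (auto simp: cell_def)
  have "p = seg a b (p b)" using p assms by (force simp: seg_def)
  moreover have "p b \<in> {0..1}" using p(1)[of a] p(1)[of b] p(3) by simp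
  ultimately show "p \<in> seg a b ` {0..1}" by blast
qed (use assms in \<open>auto simp: cell_def seg_def\<close>)

lemma path_length_nonneg: "path_length G p q l \<Longrightarrow> 0 \<le> l"
  by (induction rule: path_length.induct) auto

lemma path_length_trans:
  "path_length G p q l \<Longrightarrow> path_length G q x l' \<Longrightarrow> path_length G p x (l + l')"
proof (induction rule: path_length.induct)
  case (step e u p q x l)
  then show ?case using path_length.step[of e G u p q] by (simp add: add.assoc)
qed simp

lemma bdd_below_path_length: "bdd_below {l. path_length G p q l}"
  by (rule bdd_belowI[of _ 0]) (simp add: path_length_nonneg)

text \<open>The assumption \<open>edges_ne\<close> excludes the one-vertex graph, whose only point
  lies on no edge. With it every point has the form \<open>seg a b t\<close> for an edge
  \<open>ab\<close>.\<close>

locale conn_graph =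
  fixes G :: "'a sgraph"
  assumes simple: "finite_simple_graph G"
    and conn: "connected_graph G"
    and edges_ne: "edges G \<noteq> {}"
begin

lemma finite_verts: "finite (verts G)"
  using simple by (simp add: finite_simple_graph_def)

lemma edgeE:
  assumes "e \<in> edges G"
  obtains a b where "e = {a, b}" "a \<noteq> b" "a \<in> verts G" "b \<in> verts G"
  using assms simple unfolding finite_simple_graph_def by (metis card_2_iff insert_subset)

lemma edge_neq: "{a, b} \<in> edges G \<Longrightarrow> a \<noteq> b"
  by (erule edgeE) (auto simp: doubleton_eq_iff)

text \<open>An edge provides a vertex other than \<open>v\<close>; the first edge of a path from
  \<open>v\<close> to it contains \<open>v\<close>.\<close>

lemma verts_eq: "verts G = \<Union>(edges G)"
proof (intro equalityI subsetI)
  fix v assume v: "v \<in> verts G"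
  obtain a b where ab: "{a, b} \<in> edges G" "a \<noteq> b" "a \<in> verts G" "b \<in> verts G"
    using edges_ne edgeE by (metis ex_in_conv)
  then obtain w where w: "w \<noteq> v" "w \<in> verts G" by metis
  then have "(v, w) \<in> {(a, b). {a, b} \<in> edges G}\<^sup>*"
    using conn v unfolding connected_graph_def by blast
  then obtain u where "{v, u} \<in> edges G"
    using w(1) by (metis (mono_tags, lifting) case_prodD converse_rtranclE mem_Collect_eq)
  then show "v \<in> \<Union>(edges G)" by blast
qed (use edgeE in blast)

lemma verts_neighbour:
  assumes "v \<in> verts G" shows "\<exists>w. {v, w} \<in> edges G"
proof -
  obtain e where e: "e \<in> edges G" "v \<in> e" using assms verts_eq by blast
  then show ?thesis using edgeE[OF e(1)] by (metis insert_commute insert_iff singletonD)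
qed

lemma card_verts_le: "card (verts G) \<le> 2 * card (edges G)"
proof -
  have "card (verts G) \<le> (\<Sum>e\<in>edges G. card e)"
    unfolding verts_eq by (rule card_Union_le_sum_card)
  also have "\<dots> = 2 * card (edges G)"
    using simple by (simp add: finite_simple_graph_def)
  finally show ?thesis .
qed

lemma points_eq: "points G = (\<Union>e\<in>edges G. cell e)"
proof -
  have "cell {v} \<subseteq> (\<Union>e\<in>edges G. cell e)" if v: "v \<in> verts G" for v
  proof -
    obtain w where w: "{v, w} \<in> edges G" using verts_neighbour[OF v] by blast
    then have "cell {v} \<subseteq> cell {v, w}" using edge_neq by (force simp: cell_def)
    then show ?thesis using w by blast
  qed
  then show ?thesis unfolding points_def by blast
qed

lemma mem_points_iff:
  "p \<in> points G \<longleftrightarrow> (\<exists>a b t. {a, b} \<in> edges G \<and> 0 \<le> t \<and> t \<le> 1 \<and> p = seg a b t)"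
proof
  assume "p \<in> points G"
  then obtain e where e: "e \<in> edges G" "p \<in> cell e" unfolding points_eq by blast
  then obtain a b where ab: "e = {a, b}" "a \<noteq> b" using edgeE by metis
  then obtain t where "t \<in> {0..1}" "p = seg a b t" using e(2) cell_pair[OF ab(2)] by blast
  then show "\<exists>a b t. {a, b} \<in> edges G \<and> 0 \<le> t \<and> t \<le> 1 \<and> p = seg a b t"
    using e(1) ab(1) by (intro exI[of _ a] exI[of _ b] exI[of _ t]) simp
next
  assume "\<exists>a b t. {a, b} \<in> edges G \<and> 0 \<le> t \<and> t \<le> 1 \<and> p = seg a b t"
  then obtain a b t where *: "{a, b} \<in> edges G" "0 \<le> t" "t \<le> 1" "p = seg a b t" by blast
  then have "p \<in> cell {a, b}" using cell_pair[of a b] edge_neq by auto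
  then show "p \<in> points G" using * unfolding points_eq by blast
qed

lemma points_ne: "points G \<noteq> {}"
proof -
  obtain a b where "{a, b} \<in> edges G" using edges_ne edgeE by (metis ex_in_conv)
  then have "seg a b 0 \<in> points G" unfolding mem_points_iff by (metis order_refl zero_le_one)
  then show ?thesis by blast
qed

lemma path_length_edge:
  assumes "e \<in> edges G" "u \<in> e" "p \<in> cell e" "q \<in> cell e"
  shows "path_length G p q \<bar>p u - q u\<bar>"
proof -
  have "q \<in> points G" using assms unfolding points_eq by blast
  then show ?thesis using path_length.step[OF assms path_length.refl] by simp
qed

lemma path_length_seg:
  assumes "{a, b} \<in> edges G" "0 \<le> s" "s \<le> 1" "0 \<le> t" "t \<le> 1"
  shows "path_length G (seg a b s) (seg a b t) \<bar>s - t\<bar>"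
proof -
  have "seg a b s \<in> cell {a, b}" "seg a b t \<in> cell {a, b}"
    using assms edge_neq cell_pair[of a b] by auto
  from path_length_edge[OF assms(1) _ this, of a] show ?thesis
    by (simp add: seg_def abs_minus_commute)
qed

lemma path_length_sym: "path_length G p q l \<Longrightarrow> path_length G q p l"
proof (induction rule: path_length.induct)
  case (step e u p q x l)
  then show ?case
    using path_length_trans[OF step.IH path_length_edge[of e u q p]]
    by (simp add: abs_minus_commute add.commute)
qed (simp add: path_length.refl)

lemma path_length_verts:
  assumes "u \<in> verts G" "v \<in> verts G"
  shows "\<exists>l. path_length G (seg u u 0) (seg v v 0) l"
proof -
  have "(u, v) \<in> {(a, b). {a, b} \<in> edges G}\<^sup>*"
    using conn assms unfolding connected_graph_def by blast
  then show ?thesis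
  proof (induction rule: rtrancl_induct)
    case base
    obtain w where "{u, w} \<in> edges G"
      using verts_neighbour[OF assms(1)] by blast
    then have "seg u w 0 \<in> points G" unfolding mem_points_iff by (metis order_refl zero_le_one)
    then have "seg u u 0 \<in> points G" by (simp add: seg_0_cong[of u u w])
    then show ?case using path_length.refl by blast
  next
    case (step y z)
    then have yz: "{y, z} \<in> edges G" by simp
    have "path_length G (seg y z 0) (seg y z 1) \<bar>0 - 1\<bar>"
      using yz by (intro path_length_seg) auto
    moreover have "seg y z 1 = seg z z 0" using edge_neq[OF yz] by (auto simp: seg_def)
    ultimately show ?case using step.IH path_length_trans seg_0_cong by metis
  qed
qed

text \<open>Every point is within 1 of a vertex, and there are only finitely many pairs of vertices
  to join.\<close>

lemma path_length_bounded:
  "\<exists>D. \<forall>p\<in>points G. \<forall>q\<in>points G. \<exists>l\<le>D. path_length G p q l"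
proof -
  define L where "L = (\<lambda>(u, v). SOME l. path_length G (seg u u 0) (seg v v 0) l)"
  have L: "path_length G (seg u u 0) (seg v v 0) (L (u, v))"
    if "u \<in> verts G" "v \<in> verts G" for u v
    using someI_ex[OF path_length_verts[OF that]] by (simp add: L_def)
  \<comment> \<open>The sum is an upper bound for each chosen length because all of them are
    non-negative.\<close>
  define M where "M = (\<Sum>w\<in>verts G \<times> verts G. L w)"
  have LM: "L (u, v) \<le> M" if "u \<in> verts G" "v \<in> verts G" for u v
    unfolding M_def using that finite_verts L path_length_nonneg
    by (intro member_le_sum) fastforce+
  have near: "\<exists>a\<in>verts G. \<exists>l\<le>1. path_length G p (seg a a 0) l" if p: "p \<in> points G" for p
  proof -
    obtain a b t where *: "{a, b} \<in> edges G" "0 \<le> t" "t \<le> 1" "p = seg a b t"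
      using p mem_points_iff by blast
    have "path_length G (seg a b t) (seg a b 0) \<bar>t - 0\<bar>"
      using * by (intro path_length_seg) auto
    then have "path_length G p (seg a a 0) t" using * by (metis seg_0_cong abs_of_nonneg diff_zero)
    moreover have "a \<in> verts G" using * verts_eq by blast
    ultimately show ?thesis using * by blast
  qed
  have "\<exists>l\<le>1 + M + 1. path_length G p q l" if pq: "p \<in> points G" "q \<in> points G" for p q
  proof -
    obtain a l where a: "a \<in> verts G" "l \<le> 1" "path_length G p (seg a a 0) l"
      using near pq by blast
    obtain b l' where b: "b \<in> verts G" "l' \<le> 1" "path_length G q (seg b b 0) l'"
      using near pq by blast
    have "path_length G p q (l + L (a, b) + l')"
      using path_length_trans[OF path_length_trans[OF a(3) L[OF a(1) b(1)]] path_length_sym[OF b(3)]] .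
    moreover have "l + L (a, b) + l' \<le> 1 + M + 1"
      using a b LM[OF a(1) b(1)] by linarith
    ultimately show ?thesis by blast
  qed
  then show ?thesis by blast
qed

lemma gdist_nonneg:
  assumes "p \<in> points G" "q \<in> points G" shows "0 \<le> gdist G p q"
  unfolding gdist_def
proof (rule cInf_greatest)
  show "{l. path_length G p q l} \<noteq> {}" using path_length_bounded assms by blast
qed (simp add: path_length_nonneg)

lemma gdist_bounded:
  "\<exists>D. \<forall>p\<in>points G. \<forall>q\<in>points G. gdist G p q \<le> D"
proof -
  obtain D where D: "\<And>p q. p \<in> points G \<Longrightarrow> q \<in> points G \<Longrightarrow> \<exists>l\<le>D. path_length G p q l"
    using path_length_bounded by blast
  have "gdist G p q \<le> D" if "p \<in> points G" "q \<in> points G" for p q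
    unfolding gdist_def using D[OF that] bdd_below_path_length
    by (metis (mono_tags, lifting) cInf_lower2 mem_Collect_eq)
  then show ?thesis by blast
qed

lemma gdist_refl:
  assumes "p \<in> points G" shows "gdist G p p = 0"
proof (rule antisym)
  show "gdist G p p \<le> 0"
    unfolding gdist_def using path_length.refl[OF assms]
    by (intro cInf_lower bdd_below_path_length) simp
qed (use gdist_nonneg assms in blast)

end


section \<open>Subdivisions\<close>

text \<open>Vertices of the subdivision are points of \<open>G\<close>, so the grids of edges with a
  common end agree there and no gluing or orientation of edges is required.\<close>

definition grid :: "nat \<Rightarrow> 'a sgraph \<Rightarrow> ('a \<Rightarrow> real) set" where
  "grid r G = {seg a b (real j / real r) | a b j. {a, b} \<in> edges G \<and> j \<le> r}"

text \<open>The labelling \<open>h\<close> lets the subdivision live on an arbitrary vertex type; for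
  \<open>r = 1\<close> the subdivision is an isomorphic copy of the graph.\<close>

definition subdivide :: "nat \<Rightarrow> (('a \<Rightarrow> real) \<Rightarrow> 'b) \<Rightarrow> 'a sgraph \<Rightarrow> 'b sgraph" where
  "subdivide r h G = (h ` grid r G,
     {{h (seg a b (real j / real r)), h (seg a b (real (Suc j) / real r))} | a b j.
        {a, b} \<in> edges G \<and> j < r})"

locale subdivision = conn_graph G for G :: "'a sgraph" +
  fixes r :: nat and h :: "('a \<Rightarrow> real) \<Rightarrow> 'b"
  assumes r_pos: "0 < r" and inj: "inj_on h (grid r G)"
begin

abbreviation H :: "'b sgraph" where
  "H \<equiv> subdivide r h G"

text \<open>A new vertex has several such names: one for each direction of its old edge and, at an
  old vertex, one for each neighbour and direction. The next lemmas settle when two names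
  agree.\<close>

definition node :: "'a \<Rightarrow> 'a \<Rightarrow> nat \<Rightarrow> 'b" where
  "node a b j = h (seg a b (real j / real r))"

lemma verts_H: "verts H = {node a b j | a b j. {a, b} \<in> edges G \<and> j \<le> r}"
  by (auto simp: verts_def subdivide_def grid_def node_def)

lemma edges_H: "edges H = {{node a b j, node a b (Suc j)} | a b j. {a, b} \<in> edges G \<and> j < r}"
  by (simp add: edges_def subdivide_def node_def)

lemma node_swap:
  assumes "{a, b} \<in> edges G" "j \<le> r" shows "node a b j = node b a (r - j)"
  using seg_swap[OF edge_neq[OF assms(1)]] assms(2) r_pos
  by (simp add: node_def of_nat_diff diff_divide_distrib)

lemma node_0_cong: "node a b 0 = node a c 0"
  by (simp add: node_def seg_0_cong[of a b c])

lemma node_r: "{a, b} \<in> edges G \<Longrightarrow> node a b r = node b c 0"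
  using node_swap[of a b r] node_0_cong[of b a c] by simp

lemma grid_mem: "{a, b} \<in> edges G \<Longrightarrow> j \<le> r \<Longrightarrow> seg a b (real j / real r) \<in> grid r G"
  by (auto simp: grid_def)

lemma seg_eq_of_node_eq:
  assumes "{a, b} \<in> edges G" "j \<le> r" "{c, d} \<in> edges G" "i \<le> r" "node a b j = node c d i"
  shows "seg a b (real j / real r) = seg c d (real i / real r)"
  using inj_onD[OF inj] grid_mem[OF assms(1,2)] grid_mem[OF assms(3,4)] assms(5)
  unfolding node_def by blast

lemma node_interior_eq:
  assumes "{a, b} \<in> edges G" "0 < j" "j < r" "{c, d} \<in> edges G" "i \<le> r"
    and "node a b j = node c d i"
  shows "a = c \<and> b = d \<and> i = j \<or> a = d \<and> b = c \<and> i = r - j"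
proof -
  have "a = c \<and> b = d \<and> real i / r = real j / r
      \<or> a = d \<and> b = c \<and> real i / r = 1 - real j / r"
    using seg_interior_eq[OF seg_eq_of_node_eq[of a b j c d i]] assms edge_neq by simp
  moreover have "i = r - j" if "real i / r = 1 - real j / r"
  proof -
    have "real i = real r - real j" using that r_pos by (simp add: field_simps)
    then show ?thesis by linarith
  qed
  ultimately show ?thesis using r_pos by auto
qed

lemma node_0_eq:
  assumes "{a, b} \<in> edges G" "{c, d} \<in> edges G" "i \<le> r" "node a b 0 = node c d i"
  shows "a = c \<and> i = 0 \<or> a = d \<and> i = r"
  using seg_0_eq[of a b c d "real i / r"] seg_eq_of_node_eq[of a b 0 c d i] assms r_pos by auto

lemma node_0_inj:
  assumes "{a, b} \<in> edges G" "{c, d} \<in> edges G" "node a b 0 = node c d 0"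
  shows "a = c"
  using node_0_eq[OF assms(1,2) _ assms(3)] r_pos by simp

lemma node_Suc_neq:
  assumes "{a, b} \<in> edges G" "j < r" shows "node a b j \<noteq> node a b (Suc j)"
proof
  assume "node a b j = node a b (Suc j)"
  then have "seg a b (real j / r) = seg a b (real (Suc j) / r)"
    using assms by (intro seg_eq_of_node_eq) auto
  from fun_cong[OF this, of a] show False
    using r_pos by (simp add: seg_def field_simps)
qed

text \<open>An unordered new edge can be read in either direction: reversing the old edge turns a
  backward step into a forward one. Walks can thus always be followed with increasing index.\<close>

lemma edge_H_iff:
  "{x, y} \<in> edges H \<longleftrightarrow>
     (\<exists>a b j. {a, b} \<in> edges G \<and> j < r \<and> x = node a b j \<and> y = node a b (Suc j))"
proof
  assume "{x, y} \<in> edges H"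
  then obtain a b j where ab: "{a, b} \<in> edges G" "j < r"
    "x = node a b j \<and> y = node a b (Suc j) \<or> y = node a b j \<and> x = node a b (Suc j)"
    by (auto simp: edges_H doubleton_eq_iff)
  have "{b, a} \<in> edges G" using ab(1) by (simp add: insert_commute)
  moreover have "node a b j = node b a (Suc (r - Suc j))" "node a b (Suc j) = node b a (r - Suc j)"
    using ab node_swap[of a b j] node_swap[of a b "Suc j"] by (simp_all add: Suc_diff_Suc)
  moreover have "r - Suc j < r" using ab by simp
  ultimately show "\<exists>a b j. {a, b} \<in> edges G \<and> j < r \<and> x = node a b j \<and> y = node a b (Suc j)"
    using ab by metis
qed (auto simp: edges_H)

lemma node_edge: "{a, b} \<in> edges G \<Longrightarrow> j < r \<Longrightarrow> {node a b j, node a b (Suc j)} \<in> edges H"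
  by (auto simp: edges_H)

lemma finite_simple_H: "finite_simple_graph H"
proof -
  have "verts H = (\<lambda>(a, b, j). node a b j) ` {(a, b, j). {a, b} \<in> edges G \<and> j \<le> r}"
    unfolding verts_H by force
  moreover have "finite {(a, b, j). {a, b} \<in> edges G \<and> j \<le> r}"
    by (rule finite_subset[of _ "verts G \<times> verts G \<times> {..r}"])
      (auto simp: verts_eq finite_verts[unfolded verts_eq])
  ultimately have "finite (verts H)" by simp
  moreover have "e \<subseteq> verts H \<and> card e = 2" if e: "e \<in> edges H" for e
  proof -
    obtain a b j where ab: "{a, b} \<in> edges G" "j < r" "e = {node a b j, node a b (Suc j)}"
      using e by (auto simp: edges_H)
    have "node a b j \<in> verts H" "node a b (Suc j) \<in> verts H"
      using ab(1,2) unfolding verts_H by (blast intro: less_imp_le Suc_leI)+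
    then show ?thesis using node_Suc_neq[OF ab(1,2)] ab(3) by simp
  qed
  ultimately show ?thesis by (simp add: finite_simple_graph_def)
qed

text \<open>Each node is joined to a corner along its old edge, and corners are joined by replacing
  each edge of a path in \<open>G\<close> by its \<open>r\<close> new edges.\<close>

lemma connected_H: "connected_graph H"
proof -
  define R where "R = {(x, y). {x, y} \<in> edges H}"
  have sym: "sym (R\<^sup>*)" unfolding R_def
    by (intro sym_rtrancl symI) (simp add: insert_commute)
  have along: "(node a b 0, node a b j) \<in> R\<^sup>*" if "{a, b} \<in> edges G" "j \<le> r" for a b j
    using that(2)
  proof (induction j)
    case (Suc j)
    then have "(node a b j, node a b (Suc j)) \<in> R" using node_edge that(1) by (simp add: R_def)
    with Suc show ?case by (simp add: rtrancl.rtrancl_into_rtrancl)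
  qed simp
  have corner: "(node u u 0, node v v 0) \<in> R\<^sup>*" if "u \<in> verts G" "v \<in> verts G" for u v
  proof -
    have "(u, v) \<in> {(a, b). {a, b} \<in> edges G}\<^sup>*"
      using conn that unfolding connected_graph_def by blast
    then show ?thesis
    proof (induction rule: rtrancl_induct)
      case (step y z)
      then have yz: "{y, z} \<in> edges G" by simp
      have "(node y y 0, node z z 0) \<in> R\<^sup>*"
        using along[OF yz order_refl] node_r[OF yz, of z] node_0_cong[of y z y] by simp
      with step.IH show ?case by (rule rtrancl_trans)
    qed simp
  qed
  have "(x, y) \<in> R\<^sup>*" if xy: "x \<in> verts H" "y \<in> verts H" for x y
  proof -
    obtain a b j where x: "{a, b} \<in> edges G" "j \<le> r" "x = node a b j" using xy by (auto simp: verts_H)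
    obtain c d i where y: "{c, d} \<in> edges G" "i \<le> r" "y = node c d i" using xy by (auto simp: verts_H)
    have ac: "a \<in> verts G" "c \<in> verts G" using x y verts_eq by blast+
    have "(node a a 0, x) \<in> R\<^sup>*" "(node c c 0, y) \<in> R\<^sup>*"
      using along x y node_0_cong by metis+
    then show ?thesis using corner[OF ac] sym by (meson rtrancl_trans symD)
  qed
  moreover have "verts H \<noteq> {}"
  proof -
    obtain a b where "{a, b} \<in> edges G" using edges_ne edgeE by (metis ex_in_conv)
    then have "node a b 0 \<in> verts H" unfolding verts_H by blast
    then show ?thesis by blast
  qed
  ultimately show ?thesis unfolding connected_graph_def R_def by blast
qed

lemma edges_H_ne: "edges H \<noteq> {}"
proof -
  obtain a b where "{a, b} \<in> edges G" using edges_ne edgeE by (metis ex_in_conv)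
  then show ?thesis using node_edge[of a b 0] r_pos by blast
qed

sublocale H: conn_graph H
  by unfold_locales (simp_all add: finite_simple_H connected_H edges_H_ne)

lemma card_edges_H: "card (edges H) = r * card (edges G)"
proof -
  \<comment> \<open>Counting requires a direction for each old edge; otherwise each new edge would
    be indexed twice, as \<open>(a, b, j)\<close> and as \<open>(b, a, r - Suc j)\<close>.\<close>
  have "\<exists>f. \<forall>e\<in>edges G. e = {fst (f e), snd (f e)}"
    by (intro bchoice ballI) (metis edgeE fst_conv snd_conv)
  then obtain f where f: "\<And>e. e \<in> edges G \<Longrightarrow> {fst (f e), snd (f e)} = e" by metis
  define E where "E = (\<lambda>(e, j). {node (fst (f e)) (snd (f e)) j, node (fst (f e)) (snd (f e)) (Suc j)})"
  have "edges H = E ` (edges G \<times> {..<r})"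
  proof (intro equalityI subsetI)
    fix x assume "x \<in> edges H"
    then obtain a b j where ab: "{a, b} \<in> edges G" "j < r" "x = {node a b j, node a b (Suc j)}"
      by (auto simp: edges_H)
    from f[OF ab(1)] consider "fst (f {a, b}) = a" "snd (f {a, b}) = b"
      | "fst (f {a, b}) = b" "snd (f {a, b}) = a"
      by (auto simp: doubleton_eq_iff)
    then show "x \<in> E ` (edges G \<times> {..<r})"
    proof cases
      case 1
      then show ?thesis using ab by (intro image_eqI[of _ _ "({a, b}, j)"]) (auto simp: E_def)
    next
      case 2
      then have "x = E ({a, b}, r - Suc j)"
        using ab node_swap[of a b j] node_swap[of a b "Suc j"]
        by (simp add: E_def Suc_diff_Suc insert_commute)
      then show ?thesis using ab by (intro image_eqI[of _ _ "({a, b}, r - Suc j)"]) auto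
    qed
  qed (use f in \<open>auto simp: E_def intro!: node_edge\<close>)
  moreover have "inj_on E (edges G \<times> {..<r})"
  proof (rule inj_onI, clarsimp)
    fix e j e' j'
    assume *: "e \<in> edges G" "j < r" "e' \<in> edges G" "j' < r" "E (e, j) = E (e', j')"
    define a b c d where abcd: "a = fst (f e)" "b = snd (f e)" "c = fst (f e')" "d = snd (f e')"
    have e: "e = {a, b}" "e' = {c, d}" using f * abcd by auto
    have ab: "{a, b} \<in> edges G" "{c, d} \<in> edges G" using * e by auto
    have eq: "node a b j = node c d j' \<and> node a b (Suc j) = node c d (Suc j')
      \<or> node a b j = node c d (Suc j') \<and> node a b (Suc j) = node c d j'"
      using *(5) by (auto simp: E_def abcd doubleton_eq_iff)
    have "seg a b (real j / r) = seg c d (real j' / r) \<and> seg a b (real (Suc j) / r) = seg c d (real (Suc j') / r)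
      \<or> seg a b (real j / r) = seg c d (real (Suc j') / r) \<and> seg a b (real (Suc j) / r) = seg c d (real j' / r)"
      using eq seg_eq_of_node_eq[OF ab(1) _ ab(2)] *(2,4) by (meson Suc_leI less_imp_le)
    \<comment> \<open>the midpoint of a new edge is interior to an old edge, so it determines both\<close>
    then have sum: "seg a b (real j / r) v + seg a b (real (Suc j) / r) v
        = seg c d (real j' / r) v + seg c d (real (Suc j') / r) v" for v
      by (metis add.commute)
    have mid: "seg x y (real i / r) v + seg x y (real (Suc i) / r) v = 2 * seg x y ((2 * real i + 1) / (2 * r)) v"
      for x y :: 'a and i v
      using r_pos by (auto simp: seg_def field_simps)
    have "seg a b ((2 * real j + 1) / (2 * r)) = seg c d ((2 * real j' + 1) / (2 * r))"
      using sum unfolding mid by auto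
    then have **: "a = c \<and> b = d \<and> (2 * real j' + 1) / (2 * r) = (2 * real j + 1) / (2 * r)
      \<or> a = d \<and> b = c"
    proof -
      have "0 < (2 * real j + 1) / (2 * r)" "(2 * real j + 1) / (2 * r) < 1"
        using *(2) r_pos by simp_all
      with \<open>seg a b _ = seg c d _\<close> show ?thesis
        using seg_interior_eq edge_neq[OF ab(1)] edge_neq[OF ab(2)] by metis
    qed
    then have "e = e'" using e by auto
    moreover from this have "a = c" "b = d" using abcd by auto
    \<comment> \<open>The chosen direction depends on the edge alone, so the reversed alternative
      would force \<open>a = b\<close>.\<close>
    moreover have "(2 * real j' + 1) / (2 * r) = (2 * real j + 1) / (2 * r)"
      using ** \<open>a = c\<close> \<open>b = d\<close> edge_neq[OF ab(1)] by blast
    then have "j = j'" using r_pos by simp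
    ultimately show "e = e' \<and> j = j'" by simp
  qed
  ultimately show ?thesis by (simp add: card_image card_cartesian_product)
qed

end


section \<open>Path lengths in the subdivision compared with those in the graph\<close>

text \<open>The floor of \<open>y\<close> serves except at \<open>y = r\<close>, where it would
  point past the last of the \<open>r\<close> intervals.\<close>

lemma nat_unit_interval:
  fixes y :: real
  assumes "0 < r" "0 \<le> y" "y \<le> real r"
  shows "\<exists>j<r. real j \<le> y \<and> y \<le> real j + 1"
proof (cases "y = real r")
  case True
  then show ?thesis using assms by (intro exI[of _ "r - 1"]) auto
next
  case False
  then have "nat \<lfloor>y\<rfloor> < r" using assms by linarith
  then show ?thesis using assms by (intro exI[of _ "nat \<lfloor>y\<rfloor>"]) auto
qed

context subdivision
begin

text \<open>The barycentric extension of the inverse of \<open>h\<close>; it maps a point of the subdivision to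
  the point of \<open>G\<close> at the same place.\<close>

definition place :: "('b \<Rightarrow> real) \<Rightarrow> 'a \<Rightarrow> real" where
  "place p v = (\<Sum>x\<in>verts H. p x * inv_into (grid r G) h x v)"

text \<open>For \<open>j < r\<close> this is the point at distance \<open>j + t\<close> from the
  corner \<open>a\<close> along the subdivided edge.\<close>

definition sub_pt :: "'a \<Rightarrow> 'a \<Rightarrow> nat \<Rightarrow> real \<Rightarrow> 'b \<Rightarrow> real" where
  "sub_pt a b j t = seg (node a b j) (node a b (Suc j)) t"

lemma inv_node:
  "{a, b} \<in> edges G \<Longrightarrow> j \<le> r \<Longrightarrow> inv_into (grid r G) h (node a b j) = seg a b (real j / real r)"
  unfolding node_def by (intro inv_into_f_f inj grid_mem)

text \<open>Only the two ends of the new edge contribute to the sum in \<open>place\<close>, and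
  their weighted mean is affine in \<open>t\<close>.\<close>

lemma place_sub_pt:
  assumes ab: "{a, b} \<in> edges G" and j: "j < r"
  shows "place (sub_pt a b j t) = seg a b ((real j + t) / real r)"
proof
  fix v
  let ?F = "inv_into (grid r G) h" and ?x = "node a b j" and ?y = "node a b (Suc j)"
  have ne: "?x \<noteq> ?y" using node_Suc_neq[OF ab j] .
  have mem: "?x \<in> verts H" "?y \<in> verts H"
    using node_edge[OF ab j] unfolding H.verts_eq by blast+
  have "place (sub_pt a b j t) v
      = (\<Sum>x\<in>verts H. (if x = ?x then (1 - t) * ?F ?x v else 0) + (if x = ?y then t * ?F ?y v else 0))"
    unfolding place_def sub_pt_def using ne by (intro sum.cong) (auto simp: seg_def)
  also have "\<dots> = (1 - t) * ?F ?x v + t * ?F ?y v"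
    using mem H.finite_verts by (simp add: sum.distrib)
  also have "\<dots> = seg a b ((real j + t) / real r) v"
    using inv_node[OF ab, of j] inv_node[OF ab, of "Suc j"] j r_pos
    by (auto simp: seg_def field_simps)
  finally show "place (sub_pt a b j t) v = seg a b ((real j + t) / real r) v" .
qed

lemma mem_points_H_iff:
  "p \<in> points H \<longleftrightarrow>
     (\<exists>a b j t. {a, b} \<in> edges G \<and> j < r \<and> 0 \<le> t \<and> t \<le> 1 \<and> p = sub_pt a b j t)"
  unfolding H.mem_points_iff edge_H_iff sub_pt_def by blast

lemma sub_pt_swap:
  assumes "{a, b} \<in> edges G" "j < r"
  shows "sub_pt a b j t = sub_pt b a (r - Suc j) (1 - t)"
  using assms node_swap[of a b j] node_swap[of a b "Suc j"] seg_swap[OF node_Suc_neq[OF assms]]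
  by (simp add: sub_pt_def Suc_diff_Suc)

lemma sub_pt_1:
  assumes "{a, b} \<in> edges G" "j < r"
  shows "sub_pt a b j 1 = sub_pt a b (Suc j) 0"
  using node_Suc_neq[OF assms] by (auto simp: sub_pt_def seg_def)

lemma place_image: "place ` points H = points G"
proof (intro equalityI subsetI)
  fix P assume "P \<in> place ` points H"
  then obtain p where "p \<in> points H" "P = place p" by blast
  then obtain a b j t where p: "{a, b} \<in> edges G" "j < r" "0 \<le> t" "t \<le> 1" "P = place (sub_pt a b j t)"
    unfolding mem_points_H_iff by blast
  have "real j + t \<le> real r" using p(2,4) by linarith
  then have "0 \<le> (real j + t) / r" "(real j + t) / r \<le> 1" using p r_pos by simp_all
  then show "P \<in> points G" using p place_sub_pt unfolding mem_points_iff by metis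
next
  fix P assume "P \<in> points G"
  then obtain a b s where p: "{a, b} \<in> edges G" "0 \<le> s" "s \<le> 1" "P = seg a b s"
    unfolding mem_points_iff by blast
  have "s * r \<le> r" using p(3) by (simp add: mult_left_le_one_le p(2))
  then obtain j where j: "j < r" "real j \<le> s * r" "s * r \<le> real j + 1"
    using nat_unit_interval[of r "s * r"] p(2) r_pos by auto
  have "place (sub_pt a b j (s * r - real j)) = P"
    using place_sub_pt[OF p(1) j(1)] p(4) r_pos by simp
  moreover have "sub_pt a b j (s * r - real j) \<in> points H"
    unfolding mem_points_H_iff using p(1) j by (intro exI conjI refl) auto
  ultimately show "P \<in> place ` points H" by blast
qed

text \<open>Each step of a path lies on one new edge, which \<open>place\<close> maps into one old
  edge with lengths divided by \<open>r\<close>; paths are pushed forward step by step.\<close>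

lemma path_length_place:
  "path_length H p q l \<Longrightarrow> path_length G (place p) (place q) (l / r)"
proof (induction rule: path_length.induct)
  case (refl p)
  then show ?case using place_image by (auto intro!: path_length.refl)
next
  case (step e u p q x l)
  obtain a b j where ab: "{a, b} \<in> edges G" "j < r" "e = {node a b j, node a b (Suc j)}"
    using step.hyps(1) by (auto simp: edges_H)
  note ne = node_Suc_neq[OF ab(1,2)]
  obtain s where s: "0 \<le> s" "s \<le> 1" "p = sub_pt a b j s"
    using step.hyps(3) cell_pair[OF ne] unfolding ab(3) sub_pt_def by auto
  obtain t where t: "0 \<le> t" "t \<le> 1" "q = sub_pt a b j t"
    using step.hyps(4) cell_pair[OF ne] unfolding ab(3) sub_pt_def by auto
  have jr: "real j + 1 \<le> real r" using ab(2) by linarith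
  have "path_length G (seg a b ((real j + s) / r)) (seg a b ((real j + t) / r))
      \<bar>(real j + s) / r - (real j + t) / r\<bar>"
    using ab(1) s t jr r_pos by (intro path_length_seg) (simp_all add: field_simps)
  moreover have "\<bar>(real j + s) / r - (real j + t) / r\<bar> = \<bar>p u - q u\<bar> / r"
  proof -
    have "\<bar>p u - q u\<bar> = \<bar>s - t\<bar>"
      using step.hyps(2) ne unfolding ab(3) s(3) t(3) sub_pt_def by (auto simp: seg_def)
    then show ?thesis using r_pos by (simp flip: diff_divide_distrib)
  qed
  ultimately have "path_length G (place p) (place q) (\<bar>p u - q u\<bar> / r)"
    using place_sub_pt[OF ab(1,2)] s t by simp
  then show ?case using path_length_trans[OF _ step.IH] by (simp add: add_divide_distrib)
qed

text \<open>A single step along an old edge may cross many new edges, so lifting it requires a chain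
  of steps.\<close>

lemma path_length_sub_pt:
  assumes ab: "{a, b} \<in> edges G" and "i < r" "j < r" "0 \<le> s" "s \<le> 1" "0 \<le> t" "t \<le> 1"
  shows "path_length H (sub_pt a b i s) (sub_pt a b j t) \<bar>(real i + s) - (real j + t)\<bar>"
proof -
  have short: "path_length H (sub_pt a b i s) (sub_pt a b i t) \<bar>s - t\<bar>"
    if "i < r" "0 \<le> s" "s \<le> 1" "0 \<le> t" "t \<le> 1" for i s t
    unfolding sub_pt_def using that node_edge[OF ab] by (intro H.path_length_seg)
  \<comment> \<open>Induction on the number of nodes crossed, with \<open>t\<close> general: the
    chain is first run to the end \<open>t = 1\<close> of a new edge, which is the start of the
    next.\<close>
  have long: "path_length H (sub_pt a b i s) (sub_pt a b (i + Suc k) t) (real (Suc k) + t - s)"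
    if "i + Suc k < r" "0 \<le> s" "s \<le> 1" "0 \<le> t" "t \<le> 1" for i k s t
    using that(1,4,5)
  proof (induction k arbitrary: t)
    case 0
    have "path_length H (sub_pt a b i s) (sub_pt a b (Suc i) 0) (1 - s)"
      using short[of i s 1] that 0 sub_pt_1[OF ab, of i] by simp
    moreover have "path_length H (sub_pt a b (Suc i) 0) (sub_pt a b (Suc i) t) t"
      using short[of "Suc i" 0 t] 0 by simp
    ultimately have "path_length H (sub_pt a b i s) (sub_pt a b (Suc i) t) (1 - s + t)"
      by (rule path_length_trans)
    then show ?case by (simp add: algebra_simps)
  next
    case (Suc k)
    have "path_length H (sub_pt a b i s) (sub_pt a b (i + Suc k) 1) (real (Suc k) + 1 - s)"
      using Suc.IH[of 1] Suc.prems by simp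
    moreover have "sub_pt a b (i + Suc k) 1 = sub_pt a b (i + Suc (Suc k)) 0"
      using sub_pt_1[OF ab, of "i + Suc k"] Suc.prems by simp
    moreover have "path_length H (sub_pt a b (i + Suc (Suc k)) 0) (sub_pt a b (i + Suc (Suc k)) t) t"
      using short[of "i + Suc (Suc k)" 0 t] Suc.prems by simp
    ultimately have "path_length H (sub_pt a b i s) (sub_pt a b (i + Suc (Suc k)) t)
        (real (Suc k) + 1 - s + t)"
      using path_length_trans by metis
    then show ?case by (simp add: algebra_simps)
  qed
  consider "i = j" | k where "j = i + Suc k" | k where "i = j + Suc k"
    by (metis less_imp_Suc_add linorder_neqE_nat add_Suc_right)
  then show ?thesis
  proof cases
    case 1
    then show ?thesis using short assms by simp
  next
    case 2
    then have "\<bar>(real i + s) - (real j + t)\<bar> = real (Suc k) + t - s" using assms by simp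
    moreover have "path_length H (sub_pt a b i s) (sub_pt a b j t) (real (Suc k) + t - s)"
      unfolding 2 using assms 2 by (intro long) auto
    ultimately show ?thesis by (simp only:)
  next
    case 3
    then have "\<bar>(real i + s) - (real j + t)\<bar> = real (Suc k) + s - t" using assms by simp
    moreover have "path_length H (sub_pt a b i s) (sub_pt a b j t) (real (Suc k) + s - t)"
      unfolding 3 using assms 3 by (intro H.path_length_sym[OF long]) auto
    ultimately show ?thesis by (simp only:)
  qed
qed

text \<open>\<open>p\<close> may be given along another edge \<open>cd\<close>. If its place is
  interior to \<open>cd\<close>, the support forces \<open>{c, d} = {a, b}\<close>; otherwise
  \<open>p\<close> is a corner that lies in \<open>{a, b}\<close>.\<close>

lemma sub_pt_of_place_mem_cell:
  assumes ab: "{a, b} \<in> edges G" and p: "p \<in> points H" and cell: "place p \<in> cell {a, b}"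
  shows "\<exists>j t. j < r \<and> 0 \<le> t \<and> t \<le> 1 \<and> p = sub_pt a b j t"
proof -
  obtain c d i s where cd: "{c, d} \<in> edges G" "i < r" "0 \<le> s" "s \<le> 1" "p = sub_pt c d i s"
    using p unfolding mem_points_H_iff by blast
  have dc: "{d, c} \<in> edges G" using cd(1) by (simp add: insert_commute)
  have P: "place p = seg c d ((real i + s) / r)" using cd place_sub_pt by simp
  have van: "v \<in> {a, b}" if "place p v \<noteq> 0" for v
    using cell that by (auto simp: cell_def)
  have corner: "\<exists>j t. j < r \<and> 0 \<le> t \<and> t \<le> 1 \<and> sub_pt c d 0 0 = sub_pt a b j t" if "c \<in> {a, b}" for c d
  proof (cases "c = a")
    case True
    then have "sub_pt c d 0 0 = sub_pt a b 0 0"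
      unfolding sub_pt_def using seg_0_cong node_0_cong by metis
    then show ?thesis using r_pos by (metis order_refl zero_le_one)
  next
    case False
    then have "sub_pt c d 0 0 = sub_pt b a 0 0"
      using that unfolding sub_pt_def using seg_0_cong node_0_cong by (metis insertE singletonD)
    \<comment> \<open>The corner \<open>b\<close> is the far end of the last new edge, whose index
      is \<open>r - 1\<close>.\<close>
    also have "\<dots> = sub_pt a b (r - 1) 1"
      using sub_pt_swap[of b a 0 0] ab r_pos by (simp add: insert_commute)
    finally show ?thesis using r_pos by (metis diff_less less_one order_refl zero_le_one)
  qed
  consider "real i + s = 0" | "real i + s = r" | "0 < real i + s" "real i + s < r"
    using cd(2-4) by linarith
  then show ?thesis
  proof cases
    case 1
    then have "i = 0" "s = 0" using cd(3) by auto
    then have "p = sub_pt c d 0 0" "place p c \<noteq> 0" using cd(5) P by (simp_all add: seg_def)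
    then show ?thesis using corner van by metis
  next
    case 2
    then have "s = 1" "r = Suc i" using cd(2,4) by linarith+
    then have "p = sub_pt d c 0 0"
      using cd(5) sub_pt_swap[OF cd(1,2)] by simp
    moreover have "place p d \<noteq> 0" using P 2 r_pos edge_neq[OF cd(1)] by (simp add: seg_def)
    ultimately show ?thesis using corner van by metis
  next
    case 3
    then have "place p c \<noteq> 0" "place p d \<noteq> 0"
      using P r_pos edge_neq[OF cd(1)] by (simp_all add: seg_def)
    then have "{c, d} \<subseteq> {a, b}" using van by blast
    then consider "c = a" "d = b" | "c = b" "d = a"
      using edge_neq[OF cd(1)] by auto
    then show ?thesis
    proof cases
      case 1
      then show ?thesis using cd by blast
    next
      case 2
      then have "p = sub_pt a b (r - Suc i) (1 - s)" using cd sub_pt_swap by simp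
      moreover have "r - Suc i < r" "0 \<le> 1 - s" "1 - s \<le> 1" using cd by auto
      ultimately show ?thesis by blast
    qed
  qed
qed

lemma path_length_lift_cell:
  assumes e: "e \<in> edges G" "u \<in> e" and pq: "p \<in> points H" "q \<in> points H"
    and cells: "place p \<in> cell e" "place q \<in> cell e"
  shows "path_length H p q (r * \<bar>place p u - place q u\<bar>)"
proof -
  obtain a b where ab: "e = {a, b}" using edgeE[OF e(1)] by metis
  then have ab': "{a, b} \<in> edges G" using e by simp
  obtain i s where p: "i < r" "0 \<le> s" "s \<le> 1" "p = sub_pt a b i s"
    using sub_pt_of_place_mem_cell[OF ab' pq(1)] cells ab by blast
  obtain j t where q: "j < r" "0 \<le> t" "t \<le> 1" "q = sub_pt a b j t"
    using sub_pt_of_place_mem_cell[OF ab' pq(2)] cells ab by blast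
  have "\<bar>place p u - place q u\<bar> = \<bar>(real i + s) / r - (real j + t) / r\<bar>"
    using e(2) edge_neq[OF ab'] ab p q place_sub_pt[OF ab'] by (auto simp: seg_def)
  also have "\<dots> = \<bar>(real i + s) - (real j + t)\<bar> / r"
    using r_pos by (simp flip: diff_divide_distrib)
  finally have "r * \<bar>place p u - place q u\<bar> = \<bar>(real i + s) - (real j + t)\<bar>"
    using r_pos by simp
  then show ?thesis using path_length_sub_pt[OF ab', of i j s t] p q by simp
qed

text \<open>Path steps are lifted one at a time, with a preimage chosen for each intermediate point,
  so the starting point \<open>p\<close> must be arbitrary in the induction.\<close>

lemma path_length_lift:
  fixes l :: real
  assumes "path_length G P Q l" "p \<in> points H" "q \<in> points H" "place p = P" "place q = Q"
  shows "path_length H p q (r * l)"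
  using assms
proof (induction arbitrary: p rule: path_length.induct)
  case (refl P)
  \<comment> \<open>Injectivity of \<open>place\<close> is not at hand: \<open>p\<close> and
    \<open>q\<close> are two preimages of \<open>P\<close>, joined by a path of length 0 over an
    edge through \<open>P\<close>.\<close>
  then obtain e where e: "e \<in> edges G" "P \<in> cell e" unfolding points_eq by blast
  then obtain u where "u \<in> e" using edgeE by blast
  then show ?case using path_length_lift_cell[of e u p q] e refl by simp
next
  case (step e u P P' Q l)
  have "P' \<in> points G" using step.hyps unfolding points_eq by blast
  then have "P' \<in> place ` points H" by (simp only: place_image)
  then obtain p' where p': "p' \<in> points H" "place p' = P'" by blast
  have "path_length H p p' (r * \<bar>P u - P' u\<bar>)"
    using path_length_lift_cell[of e u p p'] step.hyps step.prems p' by simp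
  moreover have "path_length H p' q (r * l)"
    using p'(1) step.prems(2) p'(2) step.prems(4) by (rule step.IH)
  ultimately show ?case unfolding distrib_left by (rule path_length_trans)
qed

lemma gdist_H:
  assumes "p \<in> points H" "q \<in> points H"
  shows "gdist H p q = r * gdist G (place p) (place q)"
proof -
  have "{l. path_length H p q l} = (\<lambda>l. real r * l) ` {l. path_length G (place p) (place q) l}"
  proof (intro equalityI subsetI)
    fix l assume "l \<in> {l. path_length H p q l}"
    then have "path_length G (place p) (place q) (l / r)" using path_length_place by simp
    then show "l \<in> (\<lambda>l. real r * l) ` {l. path_length G (place p) (place q) l}"
      using r_pos by (intro image_eqI[of _ _ "l / r"]) auto
  qed (use path_length_lift[OF _ assms] in auto)
  moreover have "{l. path_length G (place p) (place q) l} \<noteq> {}"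
  proof -
    have "place p \<in> points G" "place q \<in> points G" using assms place_image by auto
    then show ?thesis using path_length_bounded by blast
  qed
  moreover from this have "Inf ((\<lambda>l. real r * l) ` {l. path_length G (place p) (place q) l})
      = real r * Inf {l. path_length G (place p) (place q) l}"
    using r_pos by (intro Inf_mult_left bdd_below_path_length) simp_all
  ultimately show ?thesis by (simp only: gdist_def)
qed

lemma graph_delta_H: "graph_delta H = r * graph_delta G"
proof -
  obtain D where D: "\<forall>p\<in>points H. \<forall>q\<in>points H. gdist H p q \<le> D"
    using H.gdist_bounded by blast
  \<comment> \<open>\<open>place\<close> runs from the subdivision to \<open>G\<close>, hence the
    factor \<open>1 / r\<close>.\<close>
  have "hyp_const (points G) (gdist G) = (1 / r) * hyp_const (points H) (gdist H)"
  proof (rule hyp_const_dilation[where D = D, OF _ place_image H.points_ne])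
    show "gdist G (place p) (place q) = 1 / r * gdist H p q" if "p \<in> points H" "q \<in> points H" for p q
      using gdist_H[OF that] r_pos by simp
  qed (use r_pos D H.gdist_nonneg H.gdist_refl in auto)
  then show ?thesis using r_pos by (simp add: graph_delta_def)
qed

end


section \<open>Cycles of a subdivision\<close>

context subdivision
begin

text \<open>Quotient and remainder of an index by \<open>r\<close> give the old edge and the
  position on it. The cycle is extended periodically to avoid a special case at the closing
  edge.\<close>

lemma cycle_subdivide:
  assumes "us \<in> cycles G"
  shows "\<exists>vs\<in>cycles H. length vs = r * length us"
proof -
  define k where "k = length us"
  define v where "v i = us ! (i mod k)" for i
  have k3: "3 \<le> k" and dist: "distinct us" and adj: "\<forall>i<k. {us ! i, us ! (Suc i mod k)} \<in> edges G"
    using assms by (auto simp: cycles_def k_def)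
  have vE: "{v i, v (Suc i)} \<in> edges G" for i
    using adj[rule_format, of "i mod k"] k3 by (simp add: v_def mod_Suc_eq)
  have v_inj: "i mod k = j mod k" if "v i = v j" for i j
  proof -
    have "i mod k < length us" "j mod k < length us" using k3 by (simp_all flip: k_def)
    then show ?thesis using that nth_eq_iff_index_eq[OF dist] by (simp add: v_def)
  qed
  define g where "g i = node (v (i div r)) (v (Suc (i div r))) (i mod r)" for i
  \<comment> \<open>The case \<open>j = r\<close> is included: there the index already belongs to
    the next old edge, but the corner is the same node.\<close>
  have g: "g (r * i + j) = node (v i) (v (Suc i)) j" if "j \<le> r" for i j
  proof (cases "j = r")
    case True
    have "g (r * Suc i) = node (v (Suc i)) (v (Suc (Suc i))) 0" using r_pos by (simp add: g_def)
    then show ?thesis using True node_r[OF vE] by (simp add: add.commute)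
  next
    case False
    then show ?thesis using that r_pos by (simp add: g_def)
  qed
  have gE: "{g i, g (Suc i)} \<in> edges H" for i
  proof -
    have "i mod r < r" using r_pos by simp
    then show ?thesis
      using g[of "i mod r" "i div r"] g[of "Suc (i mod r)" "i div r"]
        node_edge[OF vE, of "i mod r" "i div r"] by simp
  qed
  have g_inj: "i = i'" if "g i = g i'" "i < r * k" "i' < r * k" for i i'
  proof -
    define q j q' j' where qj: "q = i div r" "j = i mod r" "q' = i' div r" "j' = i' mod r"
    have lt: "j < r" "j' < r" "q < k" "q' < k"
      using that r_pos by (auto simp: qj less_mult_imp_div_less mult.commute)
    have eq: "node (v q) (v (Suc q)) j = node (v q') (v (Suc q')) j'"
      using that(1) by (simp add: g_def qj)
    have "q = q' \<and> j = j'"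
    proof (cases "j = 0")
      case True
      then have "v q = v q'" "j' = 0"
        using node_0_eq[OF vE vE, of j' q q'] eq lt by auto
      then show ?thesis using v_inj[of q q'] lt True by simp
    next
      case False
      then consider "v q = v q'" "j' = j" | "v q = v (Suc q')" "v (Suc q) = v q'"
        using node_interior_eq[OF vE _ lt(1) vE _ eq] lt by auto
      then show ?thesis
      proof cases
        case 1
        then show ?thesis using v_inj[of q q'] lt by simp
      next
        case 2
        \<comment> \<open>One old edge traversed in both directions would make 2 divisible by
          \<open>k\<close>, contrary to \<open>3 \<le> k\<close>.\<close>
        have "q = Suc q' mod k" "Suc q mod k = q'"
          using v_inj[OF 2(1)] v_inj[OF 2(2)] lt by simp_all
        then have "Suc (Suc q') mod k = q'" by (metis mod_Suc_eq)
        then have False using lt(4) k3 by (auto simp: mod_Suc split: if_splits)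
        then show ?thesis ..
      qed
    qed
    then show ?thesis unfolding qj by (metis div_mult_mod_eq)
  qed
  have gmod: "g (Suc i mod (r * k)) = g (Suc i)" if "i < r * k" for i
  proof (cases "Suc i = r * k")
    case True
    have "g (r * k) = node (v k) (v (Suc k)) 0" using g[of 0 k] by simp
    also have "\<dots> = node (v 0) (v (Suc 0)) 0" using node_0_cong by (simp add: v_def)
    also have "\<dots> = g 0" using g[of 0 0] by simp
    finally show ?thesis using True by simp
  next
    case False
    then show ?thesis using that by simp
  qed
  define vs where "vs = map g [0..<r * k]"
  have "vs \<in> cycles H" unfolding cycles_def
  proof (intro CollectI conjI allI impI)
    have "1 * 3 \<le> r * k" using r_pos k3 by (intro mult_le_mono) auto
    then show "3 \<le> length vs" by (simp add: vs_def)
    show "distinct vs" unfolding vs_def distinct_map by (auto intro!: inj_onI g_inj)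
    have "g i \<in> verts H" for i using gE[of i] H.verts_eq by blast
    then show "set vs \<subseteq> verts H" unfolding vs_def by auto
    show "{vs ! i, vs ! (Suc i mod length vs)} \<in> edges H" if "i < length vs" for i
    proof -
      have "i < r * k" using that by (simp add: vs_def)
      moreover from this have "Suc i mod (r * k) < r * k" by (intro mod_less_divisor) linarith
      ultimately show ?thesis using gE[of i] gmod[of i] by (simp add: vs_def)
    qed
  qed
  then show ?thesis by (intro bexI[of _ vs]) (simp_all add: vs_def k_def)
qed

text \<open>Interior nodes have degree two; this is what forbids turning off or stopping inside an
  old edge.\<close>

lemma node_neighbour:
  assumes ab: "{a, b} \<in> edges G" and j: "0 < j" "j < r" and y: "{node a b j, y} \<in> edges H"
  shows "y = node a b (j - 1) \<or> y = node a b (Suc j)"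
proof -
  obtain c d i where cd: "{c, d} \<in> edges G" "i < r" "node a b j = node c d i" "y = node c d (Suc i)"
    using y unfolding edge_H_iff by blast
  from node_interior_eq[OF ab j cd(1) _ cd(3)] cd(2)
  consider "c = a" "d = b" "i = j" | "c = b" "d = a" "i = r - j" by auto
  then show ?thesis
  proof cases
    case 1
    then show ?thesis using cd by simp
  next
    case 2
    then have "y = node a b (r - Suc (r - j))" using cd node_swap[of b a "Suc (r - j)"] by simp
    then show ?thesis using j by simp
  qed
qed

lemma node_0_neighbour:
  assumes "{a, b} \<in> edges G" "{node a b 0, y} \<in> edges H"
  shows "\<exists>c. {a, c} \<in> edges G \<and> y = node a c 1"
proof -
  obtain c d i where cd: "{c, d} \<in> edges G" "i < r" "node a b 0 = node c d i" "y = node c d (Suc i)"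
    using assms(2) unfolding edge_H_iff by blast
  then have "a = c" "i = 0" using node_0_eq[OF assms(1) cd(1) _ cd(3)] by auto
  then show ?thesis using cd by auto
qed

text \<open>At an interior node one of the two neighbours is where the walk came from, so only the
  next node remains. The step looks two positions back, hence strong induction.\<close>

lemma walk_straight:
  assumes walk: "\<And>i. {w i, w (Suc i)} \<in> edges H" and nb: "\<And>i. w (Suc (Suc i)) \<noteq> w i"
    and ab: "{a, b} \<in> edges G" and w0: "w i = node a b j" "w (Suc i) = node a b (Suc j)"
    and "j + k \<le> r"
  shows "w (i + k) = node a b (j + k)"
  using assms(6)
proof (induction k rule: less_induct)
  case (less k)
  show ?case
  proof (cases "k < 2")
    case True
    then show ?thesis using w0 by (cases k) auto
  next
    case False
    then obtain l where k: "k = Suc (Suc l)" by (metis Suc_lessI less_2_cases_iff add_2_eq_Suc le_Suc_ex not_less)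
    have l: "w (i + l) = node a b (j + l)" "w (Suc (i + l)) = node a b (Suc (j + l))"
      using less.IH[of l] less.IH[of "Suc l"] less.prems k by simp_all
    have "{node a b (Suc (j + l)), w (Suc (Suc (i + l)))} \<in> edges H"
      using walk[of "Suc (i + l)"] l by simp
    from node_neighbour[OF ab _ _ this] have "w (Suc (Suc (i + l))) = node a b (j + l)
      \<or> w (Suc (Suc (i + l))) = node a b (Suc (Suc (j + l)))"
      using less.prems k by simp
    then show ?thesis using nb[of "i + l"] l k by simp
  qed
qed

text \<open>From a corner the walk enters some old edge and, by \<open>walk_straight\<close>,
  reaches its far end after exactly \<open>r\<close> steps, where the argument repeats.\<close>

lemma walk_decompose:
  assumes walk: "\<And>i. {w i, w (Suc i)} \<in> edges H" and nb: "\<And>i. w (Suc (Suc i)) \<noteq> w i"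
    and start: "{a, b} \<in> edges G" "w 0 = node a b 0"
  shows "\<exists>v. \<forall>k. {v k, v (Suc k)} \<in> edges G \<and> (\<forall>j\<le>r. w (r * k + j) = node (v k) (v (Suc k)) j)"
proof -
  have leave: "\<exists>d. {c, d} \<in> edges G \<and> (\<forall>j\<le>r. w (i + j) = node c d j)"
    if c: "{c, c'} \<in> edges G" "w i = node c c' 0" for c c' i
  proof -
    obtain d where d: "{c, d} \<in> edges G" "w (Suc i) = node c d 1"
      using node_0_neighbour[OF c(1)] walk[of i] c(2) by auto
    have "w (i + j) = node c d (0 + j)" if "j \<le> r" for j
      by (rule walk_straight[where w = w, OF walk nb d(1)]) (use c d that node_0_cong[of c c' d] in auto)
    then show ?thesis using d(1) by auto
  qed
  have "\<exists>c d. {c, d} \<in> edges G \<and> (\<forall>j\<le>r. w (r * k + j) = node c d j)" for k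
  proof (induction k)
    case 0
    then show ?case using leave[OF start] by auto
  next
    case (Suc k)
    then obtain c d where cd: "{c, d} \<in> edges G" "\<forall>j\<le>r. w (r * k + j) = node c d j" by blast
    have "{d, c} \<in> edges G" using cd(1) by (simp add: insert_commute)
    moreover have "w (r * Suc k) = node d c 0"
      using cd(2)[rule_format, of r] node_r[OF cd(1), of c] by (simp add: add.commute)
    ultimately show ?case using leave by blast
  qed
  then obtain v v' where v: "\<And>k. {v k, v' k} \<in> edges G"
    "\<And>k j. j \<le> r \<Longrightarrow> w (r * k + j) = node (v k) (v' k) j" by metis
  have "v' k = v (Suc k)" for k
  proof -
    have "node (v' k) (v k) 0 = w (r * k + r)" using v(2)[of r k] node_r[OF v(1)] by simp
    also have "\<dots> = node (v (Suc k)) (v' (Suc k)) 0" using v(2)[of 0 "Suc k"] by (simp add: add.commute)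
    finally show ?thesis
      using node_0_inj[of "v' k" "v k" "v (Suc k)" "v' (Suc k)"] v(1)[of k] v(1)[of "Suc k"]
      by (simp add: insert_commute)
  qed
  then show ?thesis using v by (intro exI[of _ v]) simp
qed

text \<open>The cycle is read as a periodic walk, which does not backtrack because its period is at
  least 3. Shifted to start at a corner, it splits into whole old edges.\<close>

lemma cycle_of_subdivision:
  assumes "vs \<in> cycles H"
  shows "\<exists>us\<in>cycles G. length vs = r * length us"
proof -
  define n where "n = length vs"
  define w where "w i = vs ! (i mod n)" for i
  have n3: "3 \<le> n" and dist: "distinct vs" and adj: "\<forall>i<n. {vs ! i, vs ! (Suc i mod n)} \<in> edges H"
    using assms by (auto simp: cycles_def n_def)
  have wE: "{w i, w (Suc i)} \<in> edges H" for i
    using adj[rule_format, of "i mod n"] n3 by (simp add: w_def mod_Suc_eq)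
  have w_eq: "w i = w j \<longleftrightarrow> i mod n = j mod n" for i j
  proof -
    have "i mod n < length vs" "j mod n < length vs" using n3 by (simp_all flip: n_def)
    then show ?thesis using nth_eq_iff_index_eq[OF dist] by (simp add: w_def)
  qed
  have w_ne: "w i \<noteq> w j" if "i < j" "j < i + n" for i j
  proof
    assume "w i = w j"
    then have "n dvd j - i" using that(1) unfolding w_eq by (metis mod_eq_dvd_iff_nat less_imp_le)
    then show False using that by (auto dest: dvd_imp_le)
  qed
  have nb: "w (Suc (Suc i)) \<noteq> w i" for i using w_ne[of i "Suc (Suc i)"] n3 by auto
  obtain a b j where ab: "{a, b} \<in> edges G" "j < r" "w 0 = node a b j" "w (Suc 0) = node a b (Suc j)"
    using wE[of 0] unfolding edge_H_iff by blast
  \<comment> \<open>The number of steps from position \<open>j\<close> to the end \<open>b\<close>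
    of the old edge.\<close>
  define i0 where "i0 = r - j"
  have "w (0 + i0) = node a b (j + i0)"
    by (rule walk_straight[where w = w, OF wE nb ab(1,3,4)]) (use ab(2) in \<open>simp add: i0_def\<close>)
  then have i0: "w i0 = node b a 0" using ab(2) node_r[OF ab(1), of a] by (simp add: i0_def)
  define w' where "w' i = w (i0 + i)" for i
  have "\<exists>v. \<forall>k. {v k, v (Suc k)} \<in> edges G \<and> (\<forall>j\<le>r. w' (r * k + j) = node (v k) (v (Suc k)) j)"
    by (rule walk_decompose[of w' b a])
      (use wE nb ab(1) i0 in \<open>simp_all add: w'_def insert_commute\<close>)
  then obtain v where v: "\<And>k. {v k, v (Suc k)} \<in> edges G"
    "\<And>k j. j \<le> r \<Longrightarrow> w' (r * k + j) = node (v k) (v (Suc k)) j" by blast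
  have per: "w' n = w' 0" by (simp add: w'_def w_eq)
  have w'_ne: "w' i \<noteq> w' j" if "i < j" "j < i + n" for i j
    using w_ne[of "i0 + i" "i0 + j"] that by (simp add: w'_def)
  define q where "q = n div r"
  \<comment> \<open>After a full period the walk is at a corner again, and a position below
    \<open>r\<close> is a corner only if it is 0; hence \<open>r\<close> divides
    \<open>n\<close>.\<close>
  have "node (v 0) (v (Suc 0)) 0 = node (v q) (v (Suc q)) (n mod r)"
    using per v(2)[of 0 0] v(2)[of "n mod r" q] r_pos by (simp add: q_def less_imp_le)
  then have nq: "n = r * q" and vq: "v q = v 0"
    using node_0_eq[OF v(1) v(1)] r_pos mod_less_divisor[OF r_pos, of n]
    unfolding q_def by (metis less_imp_le nat_neq_iff add.right_neutral mult_div_mod_eq)+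
  have v_ne: "v i \<noteq> v j" if "i < j" "j < q" for i j
  proof
    assume "v i = v j"
    then have "w' (r * i) = w' (r * j)"
      using v(2)[of 0 i] v(2)[of 0 j] node_0_cong by simp
    moreover have "r * j < r * i + n" using that r_pos unfolding nq by (simp add: trans_less_add2)
    ultimately show False using w'_ne[of "r * i" "r * j"] that r_pos by simp
  qed
  have "q \<noteq> 0" using nq n3 by (intro notI) simp
  moreover have "q \<noteq> 1" using vq edge_neq[OF v(1)[of 0]] by auto
  moreover have "q \<noteq> 2"
  proof
    \<comment> \<open>The walk would return along the same old edge, so the nodes one step before
      and one step after the corner \<open>v 1\<close> would coincide.\<close>
    assume q2: "q = 2"
    then have "v (Suc (Suc 0)) = v 0" using vq by (simp add: numeral_2_eq_2)
    then have "w' (r + 1) = node (v 1) (v 0) 1" using v(2)[of 1 1] r_pos by simp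
    also have "\<dots> = w' (r - 1)"
      using v(1)[of 0] v(2)[of "r - 1" 0] node_swap[of "v 1" "v 0" 1] r_pos by (simp add: insert_commute)
    finally have "w' (r - 1) = w' (r + 1)" by (rule sym)
    moreover have "r - 1 < r + 1" "r + 1 < r - 1 + n" using n3 r_pos by linarith+
    ultimately show False using w'_ne by blast
  qed
  ultimately have q3: "3 \<le> q" by linarith
  define us where "us = map v [0..<q]"
  have "us \<in> cycles G" unfolding cycles_def
  proof (intro CollectI conjI allI impI)
    show "3 \<le> length us" using q3 by (simp add: us_def)
    show "distinct us" unfolding us_def distinct_map
      by (auto intro!: inj_onI) (metis v_ne linorder_neqE_nat)
    have "v i \<in> verts G" for i using v(1)[of i] verts_eq by blast
    then show "set us \<subseteq> verts G" unfolding us_def by auto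
    show "{us ! i, us ! (Suc i mod length us)} \<in> edges G" if "i < length us" for i
    proof (cases "Suc i = q")
      case True
      then show ?thesis using v(1)[of i] vq q3 by (simp add: us_def)
    next
      case False
      then show ?thesis using v(1)[of i] that by (simp add: us_def)
    qed
  qed
  then show ?thesis using nq by (intro bexI[of _ us]) (simp_all add: us_def n_def)
qed

lemma cycle_lengths_H: "length ` cycles H = (\<lambda>k. r * k) ` length ` cycles G"
proof (intro equalityI subsetI)
  fix n assume "n \<in> length ` cycles H"
  then show "n \<in> (\<lambda>k. r * k) ` length ` cycles G" using cycle_of_subdivision by blast
next
  fix n assume "n \<in> (\<lambda>k. r * k) ` length ` cycles G"
  then obtain us where us: "us \<in> cycles G" "n = r * length us" by blast
  show "n \<in> length ` cycles H" using cycle_subdivide[OF us(1)] us(2) by force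
qed

end

section \<open>Girth and circumference as attained cycle lengths\<close>

text \<open>A finite value excludes the empty infimum, and an infimum in a well-order is attained.
  In this form multiplication of all lengths by \<open>r\<close> carries over directly.\<close>

lemma girth_eq_enat_iff:
  "girth G = enat g \<longleftrightarrow> g \<in> length ` cycles G \<and> (\<forall>k\<in>length ` cycles G. g \<le> k)"
proof
  assume g: "girth G = enat g"
  then have ne: "cycles G \<noteq> {}" by (auto simp: girth_def top_enat_def)
  then obtain vs where "vs \<in> cycles G" "girth G = enat (length vs)"
    unfolding girth_def using wellorder_InfI[of _ "(\<lambda>vs. enat (length vs)) ` cycles G"] by blast
  moreover have "girth G \<le> enat (length vs)" if "vs \<in> cycles G" for vs
    unfolding girth_def using that by (rule INF_lower)
  ultimately show "g \<in> length ` cycles G \<and> (\<forall>k\<in>length ` cycles G. g \<le> k)"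
    using g by auto
next
  assume "g \<in> length ` cycles G \<and> (\<forall>k\<in>length ` cycles G. g \<le> k)"
  then show "girth G = enat g"
    unfolding girth_def by (intro antisym INF_greatest) (auto intro: INF_lower2)
qed

text \<open>A finite supremum bounds the lengths, so there are finitely many and the largest is
  attained. Without cycles the supremum would be 0, which is no cycle length.\<close>

lemma circumference_eq_enat_iff:
  assumes "cycles G \<noteq> {}"
  shows "circumference G = enat c \<longleftrightarrow> c \<in> length ` cycles G \<and> (\<forall>k\<in>length ` cycles G. k \<le> c)"
proof
  assume c: "circumference G = enat c"
  have ub: "enat (length vs) \<le> enat c" if "vs \<in> cycles G" for vs
    unfolding c[symmetric] circumference_def using that by (rule SUP_upper)
  have "length ` cycles G \<subseteq> {..c}" using ub by auto
  then have "finite (length ` cycles G)" using finite_subset by blast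
  then have "Max (length ` cycles G) \<in> length ` cycles G" "\<forall>k\<in>length ` cycles G. k \<le> Max (length ` cycles G)"
    using assms by simp_all
  moreover from this have "enat c \<le> enat (Max (length ` cycles G))"
    unfolding c[symmetric] circumference_def by (intro SUP_least) auto
  ultimately show "c \<in> length ` cycles G \<and> (\<forall>k\<in>length ` cycles G. k \<le> c)"
    using ub by (metis (no_types, lifting) antisym enat_ord_simps(1) imageE)
next
  assume "c \<in> length ` cycles G \<and> (\<forall>k\<in>length ` cycles G. k \<le> c)"
  then show "circumference G = enat c"
    unfolding circumference_def by (intro antisym SUP_least) (auto intro: SUP_upper2)
qed

lemma conn_graph_of_class:
  assumes "G \<in> graph_class g c m" "0 < m" shows "conn_graph G"
  using assms by unfold_locales (auto simp: graph_class_def)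

section \<open>Extremal hyperbolicity constants\<close>

text \<open>\<open>graph_class\<close> contains only graphs on natural numbers, so the finite grid
  is numbered. Using an initial segment confines the vertices to a range fixed by their
  number.\<close>

lemma ex_subdivision_on_nat:
  assumes "conn_graph G" "0 < r"
  shows "\<exists>h :: ('a \<Rightarrow> real) \<Rightarrow> nat. subdivision (G :: 'a sgraph) r h
    \<and> h ` grid r G = {..<card (verts (subdivide r h G))}"
proof -
  interpret conn_graph G by fact
  have "finite (grid r G)"
  proof (rule finite_subset)
    show "grid r G \<subseteq> (\<lambda>(a, b, j). seg a b (real j / real r)) ` (verts G \<times> verts G \<times> {..r})"
    proof
      fix p assume "p \<in> grid r G"
      then obtain a b j where p: "{a, b} \<in> edges G" "j \<le> r" "p = seg a b (real j / real r)"
        by (auto simp: grid_def)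
      then have "(a, b, j) \<in> verts G \<times> verts G \<times> {..r}" using verts_eq by auto
      then show "p \<in> (\<lambda>(a, b, j). seg a b (real j / real r)) ` (verts G \<times> verts G \<times> {..r})"
        using p(3) by (intro image_eqI[of _ _ "(a, b, j)"]) auto
    qed
  qed (simp add: finite_verts)
  then obtain h where h: "bij_betw h (grid r G) {..<card (grid r G)}"
    using ex_bij_betw_finite_nat[of "grid r G"] by (auto simp: atLeast0LessThan)
  then have "subdivision G r h"
    using assms by (simp add: subdivision_def subdivision_axioms_def bij_betw_def)
  moreover have "h ` grid r G = {..<card (grid r G)}" using h by (simp add: bij_betw_def)
  ultimately show ?thesis by (intro exI[of _ h]) (simp add: verts_def subdivide_def)
qed

lemma finite_delta_class:
  assumes "0 < m" shows "finite (graph_delta ` graph_class g c m)"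
proof (rule finite_subset)
  \<comment> \<open>Each vertex is an end of one of the \<open>m\<close> edges, so
    \<open>2 * m\<close> labels suffice. Pairs in \<open>?S\<close> that are not graphs do no harm,
    since only finiteness matters.\<close>
  let ?S = "Pow {..<2 * m} \<times> Pow (Pow {..<2 * m})"
  show "graph_delta ` graph_class g c m \<subseteq> graph_delta ` ?S"
  proof (rule image_subsetI)
    fix G assume G: "G \<in> graph_class g c m"
    obtain h :: "(nat \<Rightarrow> real) \<Rightarrow> nat" where h: "subdivision G 1 h"
      "h ` grid 1 G = {..<card (verts (subdivide 1 h G))}"
      using ex_subdivision_on_nat[OF conn_graph_of_class[OF G assms] zero_less_one] by blast
    interpret subdivision G 1 h by fact
    have "card (edges H) = m" using card_edges_H G by (simp add: graph_class_def)
    then have "card (verts H) \<le> 2 * m" using H.card_verts_le by simp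
    moreover have "verts H = {..<card (verts H)}"
      using h(2) by (simp only: verts_def subdivide_def fst_conv)
    ultimately have "verts H \<subseteq> {..<2 * m}" by (metis lessThan_subset_iff)
    moreover have "e \<subseteq> verts H" if "e \<in> edges H" for e using that H.verts_eq by blast
    ultimately have "verts H \<in> Pow {..<2 * m}" "edges H \<in> Pow (Pow {..<2 * m})" by blast+
    then have "H \<in> ?S" by (simp add: verts_def edges_def mem_Times_iff)
    moreover have "graph_delta G = graph_delta H" using graph_delta_H by simp
    ultimately show "graph_delta G \<in> graph_delta ` ?S" by (rule rev_image_eqI)
  qed
qed simp

lemma ex_dilated_graph:
  assumes G: "G \<in> graph_class g c m" and "0 < m" "0 < r"
  shows "\<exists>G'\<in>graph_class (r * g) (r * c) (r * m). graph_delta G' = r * graph_delta G"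
proof -
  obtain h :: "(nat \<Rightarrow> real) \<Rightarrow> nat" where "subdivision G r h"
    using ex_subdivision_on_nat[OF conn_graph_of_class[OF G \<open>0 < m\<close>] \<open>0 < r\<close>] by blast
  then interpret subdivision G r h .
  have "girth G = enat g" "circumference G = enat c" "card (edges G) = m"
    using G by (auto simp: graph_class_def)
  moreover from this have ne: "cycles G \<noteq> {}" by (auto simp: girth_eq_enat_iff)
  moreover have "cycles H \<noteq> {}" using ne cycle_subdivide by blast
  ultimately have "girth H = enat (r * g)" "circumference H = enat (r * c)" "card (edges H) = r * m"
    by (auto simp: girth_eq_enat_iff circumference_eq_enat_iff cycle_lengths_H card_edges_H)
  then have "H \<in> graph_class (r * g) (r * c) (r * m)"
    by (simp add: graph_class_def finite_simple_H connected_H)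
  then show ?thesis using graph_delta_H by blast
qed

theorem theorem2p20:
  fixes g c m r :: nat
  assumes "3 \<le> g" and "g \<le> c" and "c \<le> m"
    and "e_admissible g c m"
    and "0 < r"
  shows "alpha (r * g) (r * c) (r * m) \<le> real r * alpha g c m \<and>
         real r * alpha g c m \<le> real r * beta g c m \<and>
         real r * beta g c m \<le> beta (r * g) (r * c) (r * m)"
proof -
  let ?D = "graph_delta ` graph_class g c m"
  let ?D' = "graph_delta ` graph_class (r * g) (r * c) (r * m)"
  have m: "0 < m" "0 < r * m" using assms by simp_all
  have fin: "finite ?D" "finite ?D'" using m finite_delta_class by blast+
  have ne: "?D \<noteq> {}" using assms(4) by (simp add: e_admissible_def)
  \<comment> \<open>Both outer inequalities follow: the extreme values of \<open>?D\<close> are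
    attained, so \<open>r\<close> times each lies in \<open>?D'\<close>.\<close>
  have dil: "real r * x \<in> ?D'" if "x \<in> ?D" for x
    using that ex_dilated_graph[OF _ m(1) assms(5)] by (metis (no_types, lifting) imageE imageI)
  have "alpha (r * g) (r * c) (r * m) \<le> real r * alpha g c m"
    unfolding alpha_def using fin ne dil by (simp add: Min_in)
  moreover have "alpha g c m \<le> beta g c m"
    unfolding alpha_def beta_def using fin(1) ne by (metis Max_in Min_le)
  moreover have "real r * beta g c m \<le> beta (r * g) (r * c) (r * m)"
    unfolding beta_def using fin ne dil by (simp add: Max_in)
  ultimately show ?thesis by (simp add: mult_left_mono)
qed

end
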